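(* Let $\mathscr{C}$ be a Krull–Schmidt abelian category with enough projective objects. An additive subcategory $\mathscr{R}\subseteq\mathscr{C}$ is resolving if and only if all the following properties hold: (1) every projective object of $\mathscr{C}$ belongs to $\mathscr{R}$; (2) for every short exact sequence $0\to X\to E\to Y\to 0$ in $\mathscr{C}$ with $X,Y$ indecomposable objects of $\mathscr{R}$, one has $E\in\mathscr{R}$; (3) for every short exact sequence $0\to K\to M\to Y\to 0$ in $\mathscr{C}$ with $M\in\mathscr{R}$ and $Y$ an indecomposable object of $\mathscr{R}$, one has $K\in\mathscr{R}$.
   Context: A (full) subcategory is called additive if it is closed under finite direct sums and direct summands (in particular under isomorphisms). A full subcategory $\mathscr{R}\subseteq\mathscr{C}$ is resolving if: it is additive; it generates $\mathscr{C}$, i.e. every object $M$ of $\mathscr{C}$ admits an epimorphism $G\twoheadrightarrow M$ with $G\in\mathscr{R}$; it is closed under extensions; and it is closed under kernels of epimorphisms (if $0\to K\to M\to N\to 0$ is exact with $M,N\in\mathscr{R}$ then $K\in\mathscr{R}$). *)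

theory Defs
  imports "HOL-Algebra.Ring"
begin

section \<open>Categories and preadditive categories\<close>

record ('o, 'm) category =
  Obj :: "'o set"
  Arr :: "'m set"
  Dom :: "'m \<Rightarrow> 'o"
  Cod :: "'m \<Rightarrow> 'o"
  Ident :: "'o \<Rightarrow> 'm"
  Comp :: "'m \<Rightarrow> 'm \<Rightarrow> 'm"  (infixr \<open>\<cdot>\<index>\<close> 70)

definition Hom :: "('o, 'm, 'z) category_scheme \<Rightarrow> 'o \<Rightarrow> 'o \<Rightarrow> 'm set" where
  "Hom C X Y = {f \<in> Arr C. Dom C f = X \<and> Cod C f = Y}"

locale category =
  fixes C :: "('o, 'm, 'z) category_scheme" (structure)
  assumes dom_closed: "f \<in> Arr C \<Longrightarrow> Dom C f \<in> Obj C"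
    and cod_closed: "f \<in> Arr C \<Longrightarrow> Cod C f \<in> Obj C"
    and ident_closed: "X \<in> Obj C \<Longrightarrow> Ident C X \<in> Hom C X X"
    and comp_closed: "\<lbrakk>f \<in> Hom C X Y; g \<in> Hom C Y Z\<rbrakk> \<Longrightarrow> g \<cdot> f \<in> Hom C X Z"
    and comp_assoc: "\<lbrakk>f \<in> Hom C W X; g \<in> Hom C X Y; h \<in> Hom C Y Z\<rbrakk>
                      \<Longrightarrow> (h \<cdot> g) \<cdot> f = h \<cdot> (g \<cdot> f)"
    and ident_left: "f \<in> Hom C X Y \<Longrightarrow> Ident C Y \<cdot> f = f"
    and ident_right: "f \<in> Hom C X Y \<Longrightarrow> f \<cdot> Ident C X = f"

record ('o, 'm) preadditive = "('o, 'm) category" +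
  HomAdd :: "'m \<Rightarrow> 'm \<Rightarrow> 'm"
  HomZero :: "'o \<Rightarrow> 'o \<Rightarrow> 'm"

definition hom_group :: "('o, 'm, 'z) preadditive_scheme \<Rightarrow> 'o \<Rightarrow> 'o \<Rightarrow> 'm monoid" where
  "hom_group C X Y = \<lparr>carrier = Hom C X Y, monoid.mult = HomAdd C, one = HomZero C X Y\<rparr>"

definition end_ring :: "('o, 'm, 'z) preadditive_scheme \<Rightarrow> 'o \<Rightarrow> 'm ring" where
  "end_ring C X = \<lparr>carrier = Hom C X X, monoid.mult = Comp C, one = Ident C X,
                   zero = HomZero C X X, add = HomAdd C\<rparr>"

locale preadditive_category = category C
  for C :: "('o, 'm, 'z) preadditive_scheme" (structure) +
  assumes hom_comm_group: "\<lbrakk>X \<in> Obj C; Y \<in> Obj C\<rbrakk> \<Longrightarrow> comm_group (hom_group C X Y)"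
    and comp_add_left: "\<lbrakk>f \<in> Hom C X Y; g \<in> Hom C Y Z; h \<in> Hom C Y Z\<rbrakk>
                         \<Longrightarrow> HomAdd C g h \<cdot> f = HomAdd C (g \<cdot> f) (h \<cdot> f)"
    and comp_add_right: "\<lbrakk>f \<in> Hom C X Y; g \<in> Hom C X Y; h \<in> Hom C Y Z\<rbrakk>
                          \<Longrightarrow> h \<cdot> HomAdd C f g = HomAdd C (h \<cdot> f) (h \<cdot> g)"


section \<open>Abelian categories\<close>

definition is_mono :: "('o, 'm, 'z) category_scheme \<Rightarrow> 'm \<Rightarrow> bool" where
  "is_mono C f \<longleftrightarrow> f \<in> Arr C \<and>
     (\<forall>W. \<forall>g \<in> Hom C W (Dom C f). \<forall>h \<in> Hom C W (Dom C f).
        f \<cdot>\<^bsub>C\<^esub> g = f \<cdot>\<^bsub>C\<^esub> h \<longrightarrow> g = h)"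

definition is_epi :: "('o, 'm, 'z) category_scheme \<Rightarrow> 'm \<Rightarrow> bool" where
  "is_epi C f \<longleftrightarrow> f \<in> Arr C \<and>
     (\<forall>W. \<forall>g \<in> Hom C (Cod C f) W. \<forall>h \<in> Hom C (Cod C f) W.
        g \<cdot>\<^bsub>C\<^esub> f = h \<cdot>\<^bsub>C\<^esub> f \<longrightarrow> g = h)"

definition is_zero_object :: "('o, 'm, 'z) category_scheme \<Rightarrow> 'o \<Rightarrow> bool" where
  "is_zero_object C Z \<longleftrightarrow> Z \<in> Obj C \<and>
     (\<forall>X \<in> Obj C. (\<exists>!f. f \<in> Hom C X Z) \<and> (\<exists>!f. f \<in> Hom C Z X))"

definition is_kernel :: "('o, 'm, 'z) preadditive_scheme \<Rightarrow> 'm \<Rightarrow> 'm \<Rightarrow> bool" where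
  "is_kernel C k f \<longleftrightarrow> f \<in> Arr C \<and> k \<in> Arr C \<and> Cod C k = Dom C f \<and>
     f \<cdot>\<^bsub>C\<^esub> k = HomZero C (Dom C k) (Cod C f) \<and>
     (\<forall>W. \<forall>h \<in> Hom C W (Dom C f). f \<cdot>\<^bsub>C\<^esub> h = HomZero C W (Cod C f) \<longrightarrow>
        (\<exists>!u. u \<in> Hom C W (Dom C k) \<and> k \<cdot>\<^bsub>C\<^esub> u = h))"

definition is_cokernel :: "('o, 'm, 'z) preadditive_scheme \<Rightarrow> 'm \<Rightarrow> 'm \<Rightarrow> bool" where
  "is_cokernel C c f \<longleftrightarrow> f \<in> Arr C \<and> c \<in> Arr C \<and> Dom C c = Cod C f \<and>
     c \<cdot>\<^bsub>C\<^esub> f = HomZero C (Dom C f) (Cod C c) \<and>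
     (\<forall>W. \<forall>h \<in> Hom C (Cod C f) W. h \<cdot>\<^bsub>C\<^esub> f = HomZero C (Dom C f) W \<longrightarrow>
        (\<exists>!u. u \<in> Hom C (Cod C c) W \<and> u \<cdot>\<^bsub>C\<^esub> c = h))"

definition is_biproduct ::
  "('o, 'm, 'z) preadditive_scheme \<Rightarrow> 'o \<Rightarrow> 'o \<Rightarrow> 'o \<Rightarrow> 'm \<Rightarrow> 'm \<Rightarrow> 'm \<Rightarrow> 'm \<Rightarrow> bool" where
  "is_biproduct C A B S iA iB pA pB \<longleftrightarrow>
     A \<in> Obj C \<and> B \<in> Obj C \<and> S \<in> Obj C \<and>
     iA \<in> Hom C A S \<and> iB \<in> Hom C B S \<and> pA \<in> Hom C S A \<and> pB \<in> Hom C S B \<and>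
     pA \<cdot>\<^bsub>C\<^esub> iA = Ident C A \<and> pB \<cdot>\<^bsub>C\<^esub> iB = Ident C B \<and>
     pB \<cdot>\<^bsub>C\<^esub> iA = HomZero C A B \<and> pA \<cdot>\<^bsub>C\<^esub> iB = HomZero C B A \<and>
     HomAdd C (iA \<cdot>\<^bsub>C\<^esub> pA) (iB \<cdot>\<^bsub>C\<^esub> pB) = Ident C S"

locale abelian_category = preadditive_category +
  assumes zero_object: "\<exists>Z. is_zero_object C Z"
    and biproducts: "\<lbrakk>A \<in> Obj C; B \<in> Obj C\<rbrakk> \<Longrightarrow> \<exists>S iA iB pA pB. is_biproduct C A B S iA iB pA pB"
    and kernels: "f \<in> Arr C \<Longrightarrow> \<exists>k. is_kernel C k f"
    and cokernels: "f \<in> Arr C \<Longrightarrow> \<exists>c. is_cokernel C c f"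
    and mono_normal: "is_mono C f \<Longrightarrow> \<exists>g. is_kernel C f g"
    and epi_normal: "is_epi C f \<Longrightarrow> \<exists>g. is_cokernel C f g"

text \<open>The image of a morphism is the kernel of its cokernel; exactness at an object compares
  it with the kernel of the following morphism, up to isomorphism of subobjects.\<close>

definition is_image :: "('o, 'm, 'z) preadditive_scheme \<Rightarrow> 'm \<Rightarrow> 'm \<Rightarrow> bool" where
  "is_image C m f \<longleftrightarrow> (\<exists>c. is_cokernel C c f \<and> is_kernel C m c)"

definition exact_at :: "('o, 'm, 'z) preadditive_scheme \<Rightarrow> 'm \<Rightarrow> 'm \<Rightarrow> bool" where
  "exact_at C f g \<longleftrightarrow> (\<exists>m. is_image C m f \<and> is_kernel C m g)"

definition short_exact ::
  "('o, 'm, 'z) preadditive_scheme \<Rightarrow> 'o \<Rightarrow> 'm \<Rightarrow> 'o \<Rightarrow> 'm \<Rightarrow> 'o \<Rightarrow> bool" where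
  "short_exact C X f E g Y \<longleftrightarrow> f \<in> Hom C X E \<and> g \<in> Hom C E Y \<and>
     (\<exists>Z. is_zero_object C Z \<and>
        exact_at C (HomZero C Z X) f \<and> exact_at C f g \<and> exact_at C g (HomZero C Y Z))"

definition is_projective :: "('o, 'm, 'z) category_scheme \<Rightarrow> 'o \<Rightarrow> bool" where
  "is_projective C P \<longleftrightarrow> P \<in> Obj C \<and>
     (\<forall>g. is_epi C g \<longrightarrow> (\<forall>f \<in> Hom C P (Cod C g). \<exists>u \<in> Hom C P (Dom C g). g \<cdot>\<^bsub>C\<^esub> u = f))"

definition enough_projectives :: "('o, 'm, 'z) category_scheme \<Rightarrow> bool" where
  "enough_projectives C \<longleftrightarrow>
     (\<forall>X \<in> Obj C. \<exists>P g. is_projective C P \<and> g \<in> Hom C P X \<and> is_epi C g)"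


section \<open>Direct sums and Krull--Schmidt categories\<close>

definition is_direct_sum ::
  "('o, 'm, 'z) preadditive_scheme \<Rightarrow> nat \<Rightarrow> (nat \<Rightarrow> 'o) \<Rightarrow> 'o \<Rightarrow> (nat \<Rightarrow> 'm) \<Rightarrow> (nat \<Rightarrow> 'm) \<Rightarrow> bool"
  where
  "is_direct_sum C n A S i p \<longleftrightarrow> S \<in> Obj C \<and>
     (\<forall>k<n. A k \<in> Obj C \<and> i k \<in> Hom C (A k) S \<and> p k \<in> Hom C S (A k)) \<and>
     (\<forall>j<n. \<forall>k<n. p j \<cdot>\<^bsub>C\<^esub> i k = (if j = k then Ident C (A k) else HomZero C (A k) (A j))) \<and>
     (\<Oplus>\<^bsub>end_ring C S\<^esub>k\<in>{..<n}. i k \<cdot>\<^bsub>C\<^esub> p k) = Ident C S"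

definition indecomposable :: "('o, 'm, 'z) preadditive_scheme \<Rightarrow> 'o \<Rightarrow> bool" where
  "indecomposable C X \<longleftrightarrow> X \<in> Obj C \<and> \<not> is_zero_object C X \<and>
     (\<forall>A B iA iB pA pB. is_biproduct C A B X iA iB pA pB \<longrightarrow>
        is_zero_object C A \<or> is_zero_object C B)"

text \<open>The ring need not be commutative: local means nonzero with the non-units closed under
  addition.\<close>

definition local_ring :: "('a, 'b) ring_scheme \<Rightarrow> bool" where
  "local_ring R \<longleftrightarrow> ring R \<and> \<one>\<^bsub>R\<^esub> \<noteq> \<zero>\<^bsub>R\<^esub> \<and>
     (\<forall>a \<in> carrier R - Units R. \<forall>b \<in> carrier R - Units R. a \<oplus>\<^bsub>R\<^esub> b \<notin> Units R)"

definition krull_schmidt :: "('o, 'm, 'z) preadditive_scheme \<Rightarrow> bool" where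
  "krull_schmidt C \<longleftrightarrow>
     (\<forall>X \<in> Obj C. \<exists>n A i p. is_direct_sum C n A X i p \<and> (\<forall>k<n. local_ring (end_ring C (A k))))"


section \<open>Resolving subcategories\<close>

text \<open>A full subcategory is represented by its set of objects. The direct sums below range over
  all direct sum objects, so the one-term sums give closure under isomorphism and the empty sum
  gives the zero objects.\<close>

definition additive_subcategory :: "('o, 'm, 'z) preadditive_scheme \<Rightarrow> 'o set \<Rightarrow> bool" where
  "additive_subcategory C R \<longleftrightarrow> R \<subseteq> Obj C \<and>
     (\<forall>n A S i p. is_direct_sum C n A S i p \<longrightarrow> (\<forall>k<n. A k \<in> R) \<longrightarrow> S \<in> R) \<and>
     (\<forall>A B S iA iB pA pB. is_biproduct C A B S iA iB pA pB \<longrightarrow> S \<in> R \<longrightarrow> A \<in> R)"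

definition generating :: "('o, 'm, 'z) category_scheme \<Rightarrow> 'o set \<Rightarrow> bool" where
  "generating C R \<longleftrightarrow> (\<forall>M \<in> Obj C. \<exists>G \<in> R. \<exists>g \<in> Hom C G M. is_epi C g)"

definition closed_under_extensions :: "('o, 'm, 'z) preadditive_scheme \<Rightarrow> 'o set \<Rightarrow> bool" where
  "closed_under_extensions C R \<longleftrightarrow>
     (\<forall>X f E g Y. short_exact C X f E g Y \<longrightarrow> X \<in> R \<longrightarrow> Y \<in> R \<longrightarrow> E \<in> R)"

definition closed_under_epi_kernels :: "('o, 'm, 'z) preadditive_scheme \<Rightarrow> 'o set \<Rightarrow> bool" where
  "closed_under_epi_kernels C R \<longleftrightarrow>
     (\<forall>K f M g N. short_exact C K f M g N \<longrightarrow> M \<in> R \<longrightarrow> N \<in> R \<longrightarrow> K \<in> R)"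

definition resolving :: "('o, 'm, 'z) preadditive_scheme \<Rightarrow> 'o set \<Rightarrow> bool" where
  "resolving C R \<longleftrightarrow> additive_subcategory C R \<and> generating C R \<and>
     closed_under_extensions C R \<and> closed_under_epi_kernels C R"

end

(* Epimorphism kernels: if N = A + B with A indecomposable, an exact sequence 0 -> K -> M -> N -> 0
   breaks up into 0 -> L -> M -> A -> 0 and 0 -> K -> L -> B -> 0, so induction on the number of
   summands of N applies; that L -> B is epi is seen by lifting a projective mapping onto B along M -> N.

   Extensions: the same breaking up of Y in 0 -> X -> E -> Y -> 0 reduces to Y indecomposable, with
   X arbitrary. For X = A + B one then uses the two quotients D1 = E/B and D2 = E/A, which are
   extensions of Y by A and by B: their fibre product over Y is E, so that there is an exact sequence
   0 -> E -> D1 + D2 -> Y -> 0, and closure under kernels of epimorphisms onto Y gives E. *)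

theory Submission
  imports Defs
begin

text \<open>The obvious route for extensions filters E by B, as 0 -> B -> E -> E/B -> 0 with E/B an
  extension of Y by A. It does not close up: E/B lies in the subcategory but need not be
  indecomposable, so an induction on X over indecomposable right ends does not cover this sequence.
  This is why a condition on kernels enters the proof about extensions: D1 and D2 both lie over the
  same indecomposable Y, their left ends are the indecomposable A and the B covered by the
  induction, and E is recovered from D1 + D2 without forming another extension.

  Sums are peeled off one indecomposable at a time. For this the formula expressing the identity as
  a sum is replaced by its consequence that an arrow vanishing on all inclusions is zero, a
  condition that passes to a complement without any computation with sums.\<close>

context category
begin

lemma Hom_obj: "f \<in> Hom C X Y \<Longrightarrow> X \<in> Obj C \<and> Y \<in> Obj C"
  using dom_closed cod_closed by (auto simp: Hom_def)

text \<open>Typing of composites in a form suited to the simplifier: unfolding \<open>Hom\<close>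
  leaves equations between \<open>Dom\<close> and \<open>Cod\<close>, which these rules and their
  companions for identities, zeros and sums discharge.\<close>

lemma comp_simps [simp]:
  assumes "f \<in> Arr C" "g \<in> Arr C" "Cod C f = Dom C g"
  shows "g \<cdot> f \<in> Arr C" "Dom C (g \<cdot> f) = Dom C f" "Cod C (g \<cdot> f) = Cod C g"
  using comp_closed[of f "Dom C f" "Cod C f" g "Cod C g"] assms by (auto simp: Hom_def)

lemma ident_simps [simp]:
  assumes "X \<in> Obj C"
  shows "Ident C X \<in> Arr C" "Dom C (Ident C X) = X" "Cod C (Ident C X) = X"
  using ident_closed[OF assms] by (auto simp: Hom_def)

lemma comp_ident [simp]:
  assumes "f \<in> Arr C"
  shows "Dom C f = X \<Longrightarrow> f \<cdot> Ident C X = f" "Cod C f = Y \<Longrightarrow> Ident C Y \<cdot> f = f"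
  using ident_left[of f "Dom C f" "Cod C f"] ident_right[of f "Dom C f" "Cod C f"] assms
  by (auto simp: Hom_def)

lemma comp_assoc_arr [simp]:
  assumes "f \<in> Arr C" "g \<in> Arr C" "h \<in> Arr C" "Cod C f = Dom C g" "Cod C g = Dom C h"
  shows "(h \<cdot> g) \<cdot> f = h \<cdot> (g \<cdot> f)"
  using comp_assoc[of f "Dom C f" "Cod C f" g "Cod C g" h "Cod C h"] assms by (auto simp: Hom_def)

lemma mono_cancel:
  assumes "is_mono C k" "k \<in> Hom C K A" "u \<in> Hom C W K" "v \<in> Hom C W K" "k \<cdot> u = k \<cdot> v"
  shows "u = v"
  using assms unfolding is_mono_def by (auto simp: Hom_def)

lemma epi_cancel:
  assumes "is_epi C c" "c \<in> Hom C A B" "u \<in> Hom C B W" "v \<in> Hom C B W" "u \<cdot> c = v \<cdot> c"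
  shows "u = v"
  using assms unfolding is_epi_def by (auto simp: Hom_def)

text \<open>Serves to recognise an epi from one factorisation: of an identity, of an epi out of a
  projective object, or of an epi already known from a short exact sequence.\<close>

lemma epi_comp_imp_epi:
  assumes "is_epi C (g \<cdot> u)" "u \<in> Hom C P A" "g \<in> Hom C A B"
  shows "is_epi C g"
  unfolding is_epi_def
proof (intro conjI allI ballI impI)
  show "g \<in> Arr C" using assms by (simp add: Hom_def)
next
  fix W a b
  assume "a \<in> Hom C (Cod C g) W" "b \<in> Hom C (Cod C g) W" and eq: "a \<cdot> g = b \<cdot> g"
  then have a: "a \<in> Hom C B W" and b: "b \<in> Hom C B W" using assms by (auto simp: Hom_def)
  have "a \<cdot> (g \<cdot> u) = b \<cdot> (g \<cdot> u)"
    using a b assms(2,3) comp_assoc[of u _ _ g _ a] comp_assoc[of u _ _ g _ b] eq by metis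
  then show "a = b" using epi_cancel[OF assms(1) _ a b] comp_closed assms(2,3) by blast
qed

lemma epi_comp:
  assumes "is_epi C f" "is_epi C g" "f \<in> Hom C A B" "g \<in> Hom C B D"
  shows "is_epi C (g \<cdot> f)"
  unfolding is_epi_def
proof (intro conjI allI ballI impI)
  show "g \<cdot> f \<in> Arr C" using assms by (simp add: Hom_def)
next
  fix W a b
  assume "a \<in> Hom C (Cod C (g \<cdot> f)) W" "b \<in> Hom C (Cod C (g \<cdot> f)) W"
    and eq: "a \<cdot> (g \<cdot> f) = b \<cdot> (g \<cdot> f)"
  then have a: "a \<in> Hom C D W" and b: "b \<in> Hom C D W" using assms by (auto simp: Hom_def)
  have "(a \<cdot> g) \<cdot> f = (b \<cdot> g) \<cdot> f" using a b assms eq by (simp add: Hom_def)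
  then have "a \<cdot> g = b \<cdot> g"
    using epi_cancel[OF assms(1,3)] comp_closed[OF assms(4)] a b by blast
  then show "a = b" by (rule epi_cancel[OF assms(2,4) a b])
qed

end

section \<open>Hom groups, negation and zero arrows\<close>

context preadditive_category
begin

lemma zero_hom [simp]:
  assumes "X \<in> Obj C" "Y \<in> Obj C"
  shows "HomZero C X Y \<in> Hom C X Y"
proof -
  interpret G: comm_group "hom_group C X Y" using hom_comm_group assms by blast
  show ?thesis using G.one_closed by (simp add: hom_group_def)
qed

lemma zero_arr [simp]:
  assumes "X \<in> Obj C" "Y \<in> Obj C"
  shows "HomZero C X Y \<in> Arr C" "Dom C (HomZero C X Y) = X" "Cod C (HomZero C X Y) = Y"
  using zero_hom[OF assms] by (auto simp: Hom_def)

lemma add_hom: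
  assumes "f \<in> Hom C X Y" "g \<in> Hom C X Y"
  shows "HomAdd C f g \<in> Hom C X Y"
proof -
  interpret G: comm_group "hom_group C X Y" using hom_comm_group Hom_obj assms(1) by blast
  show ?thesis using G.m_closed[of f g] assms by (simp add: hom_group_def)
qed

lemma add_arr [simp]:
  assumes "f \<in> Arr C" "g \<in> Arr C" "Dom C f = Dom C g" "Cod C f = Cod C g"
  shows "HomAdd C f g \<in> Arr C" "Dom C (HomAdd C f g) = Dom C g" "Cod C (HomAdd C f g) = Cod C g"
  using add_hom[of f "Dom C g" "Cod C g" g] assms by (auto simp: Hom_def)

lemma add_zero_right:
  assumes "f \<in> Hom C X Y"
  shows "HomAdd C f (HomZero C X Y) = f"
proof -
  interpret G: comm_group "hom_group C X Y" using hom_comm_group Hom_obj assms(1) by blast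
  show ?thesis using G.r_one[of f] assms by (simp add: hom_group_def)
qed

lemma add_zero_left:
  assumes "f \<in> Hom C X Y"
  shows "HomAdd C (HomZero C X Y) f = f"
proof -
  interpret G: comm_group "hom_group C X Y" using hom_comm_group Hom_obj assms(1) by blast
  show ?thesis using G.l_one[of f] assms by (simp add: hom_group_def)
qed

lemma add_comm:
  assumes "f \<in> Hom C X Y" "g \<in> Hom C X Y"
  shows "HomAdd C f g = HomAdd C g f"
proof -
  interpret G: comm_group "hom_group C X Y" using hom_comm_group Hom_obj assms(1) by blast
  show ?thesis using G.m_comm[of f g] assms by (simp add: hom_group_def)
qed

lemma add_assoc:
  assumes "f \<in> Hom C X Y" "g \<in> Hom C X Y" "h \<in> Hom C X Y"
  shows "HomAdd C (HomAdd C f g) h = HomAdd C f (HomAdd C g h)"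
proof -
  interpret G: comm_group "hom_group C X Y" using hom_comm_group Hom_obj assms(1) by blast
  show ?thesis using G.m_assoc[of f g h] assms by (simp add: hom_group_def)
qed

lemma add_right_cancel:
  assumes "f \<in> Hom C X Y" "g \<in> Hom C X Y" "h \<in> Hom C X Y" "HomAdd C f h = HomAdd C g h"
  shows "f = g"
proof -
  interpret G: comm_group "hom_group C X Y" using hom_comm_group Hom_obj assms(1) by blast
  show ?thesis using G.right_cancel[of h f g] assms by (simp add: hom_group_def)
qed

text \<open>The record has no subtraction. The inverse is taken in the hom group selected by the
  endpoints of the arrow itself, so no objects have to be passed as arguments.\<close>

definition neg :: "'m \<Rightarrow> 'm" where
  "neg f = m_inv (hom_group C (Dom C f) (Cod C f)) f"

lemma neg_hom:
  assumes "f \<in> Hom C X Y"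
  shows "neg f \<in> Hom C X Y"
proof -
  interpret G: comm_group "hom_group C X Y" using hom_comm_group Hom_obj assms(1) by blast
  show ?thesis using G.inv_closed[of f] assms by (simp add: hom_group_def neg_def Hom_def)
qed

lemma neg_arr [simp]:
  assumes "f \<in> Arr C"
  shows "neg f \<in> Arr C" "Dom C (neg f) = Dom C f" "Cod C (neg f) = Cod C f"
  using neg_hom[of f "Dom C f" "Cod C f"] assms by (auto simp: Hom_def)

lemma add_neg:
  assumes "f \<in> Hom C X Y"
  shows "HomAdd C f (neg f) = HomZero C X Y" "HomAdd C (neg f) f = HomZero C X Y"
proof -
  interpret G: comm_group "hom_group C X Y" using hom_comm_group Hom_obj assms(1) by blast
  have "neg f = m_inv (hom_group C X Y) f" using assms by (simp add: neg_def Hom_def)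
  then show "HomAdd C f (neg f) = HomZero C X Y" "HomAdd C (neg f) f = HomZero C X Y"
    using G.r_inv[of f] G.l_inv[of f] assms by (simp_all add: hom_group_def)
qed

lemma add_comp:
  assumes "f \<in> Arr C" "g \<in> Arr C" "h \<in> Arr C" "Cod C f = Dom C g" "Dom C h = Dom C g"
    "Cod C h = Cod C g"
  shows "HomAdd C g h \<cdot> f = HomAdd C (g \<cdot> f) (h \<cdot> f)"
  using comp_add_left[of f "Dom C f" "Cod C f" g "Cod C g" h] assms by (auto simp: Hom_def)

lemma comp_add:
  assumes "f \<in> Arr C" "g \<in> Arr C" "h \<in> Arr C" "Cod C f = Dom C h" "Dom C f = Dom C g"
    "Cod C f = Cod C g"
  shows "h \<cdot> HomAdd C f g = HomAdd C (h \<cdot> f) (h \<cdot> g)"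
  using comp_add_right[of f "Dom C f" "Cod C f" g h "Cod C h"] assms by (auto simp: Hom_def)

text \<open>Preservation of zero is not an axiom but follows from distributivity: z = f 0 satisfies
  z + z = z, and one z cancels.\<close>

lemma comp_zero [simp]:
  assumes f: "f \<in> Arr C" "Dom C f = X" and W: "W \<in> Obj C"
  shows "f \<cdot> HomZero C W X = HomZero C W (Cod C f)"
proof -
  have X: "X \<in> Obj C" and Y: "Cod C f \<in> Obj C" using f dom_closed cod_closed by auto
  have fz: "f \<cdot> HomZero C W X \<in> Hom C W (Cod C f)" using f W X by (simp add: Hom_def)
  have "HomAdd C (f \<cdot> HomZero C W X) (f \<cdot> HomZero C W X) = f \<cdot> HomZero C W X"
    using comp_add[of "HomZero C W X" "HomZero C W X" f] f W X
    by (simp add: add_zero_left[OF zero_hom])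
  then show ?thesis
    using add_right_cancel[OF fz _ fz, of "HomZero C W (Cod C f)"] add_zero_left[OF fz] W Y by simp
qed

lemma zero_comp [simp]:
  assumes f: "f \<in> Arr C" "Cod C f = Y" and W: "W \<in> Obj C"
  shows "HomZero C Y W \<cdot> f = HomZero C (Dom C f) W"
proof -
  have X: "Dom C f \<in> Obj C" and Y: "Y \<in> Obj C" using f dom_closed cod_closed by auto
  have fz: "HomZero C Y W \<cdot> f \<in> Hom C (Dom C f) W" using f W Y by (simp add: Hom_def)
  have "HomAdd C (HomZero C Y W \<cdot> f) (HomZero C Y W \<cdot> f) = HomZero C Y W \<cdot> f"
    using add_comp[of f "HomZero C Y W" "HomZero C Y W"] f W Y
    by (simp add: add_zero_left[OF zero_hom])
  then show ?thesis
    using add_right_cancel[OF fz _ fz, of "HomZero C (Dom C f) W"] add_zero_left[OF fz] W X by simp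
qed

lemma eq_neg_iff:
  assumes "f \<in> Hom C X Y" "g \<in> Hom C X Y"
  shows "f = neg g \<longleftrightarrow> HomAdd C f g = HomZero C X Y"
  using add_right_cancel[OF assms(1) neg_hom[OF assms(2)] assms(2)] add_neg[OF assms(2)] by auto

lemma neg_comp:
  assumes "f \<in> Arr C" "g \<in> Arr C" "Cod C f = Dom C g"
  shows "neg g \<cdot> f = neg (g \<cdot> f)"
proof -
  have "HomAdd C (neg g \<cdot> f) (g \<cdot> f) = HomZero C (Dom C f) (Cod C g)"
    using assms add_neg(2)[of g "Dom C g" "Cod C g"] cod_closed[of g]
    by (simp add: Hom_def flip: add_comp)
  moreover have "neg g \<cdot> f \<in> Hom C (Dom C f) (Cod C g)" "g \<cdot> f \<in> Hom C (Dom C f) (Cod C g)"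
    using assms by (simp_all add: Hom_def)
  ultimately show ?thesis using eq_neg_iff by blast
qed

lemma comp_neg:
  assumes "f \<in> Arr C" "g \<in> Arr C" "Cod C f = Dom C g"
  shows "g \<cdot> neg f = neg (g \<cdot> f)"
proof -
  have "HomAdd C (g \<cdot> neg f) (g \<cdot> f) = HomZero C (Dom C f) (Cod C g)"
    using assms add_neg(2)[of f "Dom C f" "Cod C f"] dom_closed[of f]
    by (simp add: Hom_def flip: comp_add)
  moreover have "g \<cdot> neg f \<in> Hom C (Dom C f) (Cod C g)" "g \<cdot> f \<in> Hom C (Dom C f) (Cod C g)"
    using assms by (simp_all add: Hom_def)
  ultimately show ?thesis using eq_neg_iff by blast
qed

lemma neg_neg:
  assumes "f \<in> Arr C"
  shows "neg (neg f) = f"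
proof -
  have f: "f \<in> Hom C (Dom C f) (Cod C f)" using assms by (simp add: Hom_def)
  show ?thesis using eq_neg_iff[OF f neg_hom[OF f]] add_neg(1)[OF f] by metis
qed

lemma diff_zero_imp_eq:
  assumes "f \<in> Hom C X Y" "g \<in> Hom C X Y" "HomAdd C f (neg g) = HomZero C X Y"
  shows "f = g"
  using eq_neg_iff[OF assms(1) neg_hom[OF assms(2)]] assms neg_neg[of g] by (simp add: Hom_def)

text \<open>Two arrows with equal composites differ by an arrow that \<open>f\<close> kills, so
  testing against zero is enough.\<close>

lemma is_monoI:
  assumes f: "f \<in> Hom C X Y"
    and z: "\<And>W w. w \<in> Hom C W X \<Longrightarrow> f \<cdot> w = HomZero C W Y \<Longrightarrow> w = HomZero C W X"
  shows "is_mono C f"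
  unfolding is_mono_def
proof (intro conjI allI ballI impI)
  show "f \<in> Arr C" using f by (simp add: Hom_def)
next
  fix W g h
  assume "g \<in> Hom C W (Dom C f)" "h \<in> Hom C W (Dom C f)" and eq: "f \<cdot> g = f \<cdot> h"
  then have g: "g \<in> Hom C W X" and h: "h \<in> Hom C W X" using f by (auto simp: Hom_def)
  have d: "HomAdd C g (neg h) \<in> Hom C W X" using add_hom[OF g neg_hom[OF h]] .
  have "f \<cdot> HomAdd C g (neg h) = HomAdd C (f \<cdot> h) (neg (f \<cdot> h))"
    using comp_add[of g "neg h" f] comp_neg[of h f] f g h eq by (simp add: Hom_def)
  also have "\<dots> = HomZero C W Y" using add_neg(1) comp_closed[OF h f] by blast
  finally show "g = h" using diff_zero_imp_eq[OF g h z[OF d]] by blast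
qed

lemma is_epiI:
  assumes f: "f \<in> Hom C X Y"
    and z: "\<And>W w. w \<in> Hom C Y W \<Longrightarrow> w \<cdot> f = HomZero C X W \<Longrightarrow> w = HomZero C Y W"
  shows "is_epi C f"
  unfolding is_epi_def
proof (intro conjI allI ballI impI)
  show "f \<in> Arr C" using f by (simp add: Hom_def)
next
  fix W g h
  assume "g \<in> Hom C (Cod C f) W" "h \<in> Hom C (Cod C f) W" and eq: "g \<cdot> f = h \<cdot> f"
  then have g: "g \<in> Hom C Y W" and h: "h \<in> Hom C Y W" using f by (auto simp: Hom_def)
  have d: "HomAdd C g (neg h) \<in> Hom C Y W" using add_hom[OF g neg_hom[OF h]] .
  have "HomAdd C g (neg h) \<cdot> f = HomAdd C (h \<cdot> f) (neg (h \<cdot> f))"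
    using add_comp[of f g "neg h"] neg_comp[of f h] f g h eq by (simp add: Hom_def)
  also have "\<dots> = HomZero C X W" using add_neg(1) comp_closed[OF f h] by blast
  finally show "g = h" using diff_zero_imp_eq[OF g h z[OF d]] by blast
qed

lemma comp_comp_zero:
  assumes "a \<in> Hom C X Y" "b \<in> Hom C Y Z" "b \<cdot> a = HomZero C X Z" "h \<in> Hom C W X"
  shows "b \<cdot> (a \<cdot> h) = HomZero C W Z"
proof -
  have "b \<cdot> (a \<cdot> h) = (b \<cdot> a) \<cdot> h" by (rule comp_assoc[OF assms(4,1,2), symmetric])
  also have "\<dots> = HomZero C W Z"
    using assms Hom_obj[OF assms(2)] by (simp add: Hom_def)
  finally show ?thesis .
qed

lemma neg_zero:
  assumes "X \<in> Obj C" "Y \<in> Obj C"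
  shows "neg (HomZero C X Y) = HomZero C X Y"
  using add_neg(1)[OF zero_hom[OF assms]] add_zero_left[OF neg_hom[OF zero_hom[OF assms]]] by simp

lemma mono_zero:
  assumes "is_mono C f" "f \<in> Hom C X Y" "w \<in> Hom C W X" "f \<cdot> w = HomZero C W Y"
  shows "w = HomZero C W X"
proof (rule mono_cancel[OF assms(1-3)])
  have o: "W \<in> Obj C" "X \<in> Obj C" using Hom_obj assms by blast+
  show "HomZero C W X \<in> Hom C W X" using o by simp
  show "f \<cdot> w = f \<cdot> HomZero C W X" using assms o by (simp add: Hom_def)
qed

lemma epi_zero:
  assumes "is_epi C f" "f \<in> Hom C X Y" "w \<in> Hom C Y W" "w \<cdot> f = HomZero C X W"
  shows "w = HomZero C Y W"
proof (rule epi_cancel[OF assms(1-3)])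
  have o: "W \<in> Obj C" "Y \<in> Obj C" using Hom_obj assms by blast+
  show "HomZero C Y W \<in> Hom C Y W" using o by simp
  show "w \<cdot> f = HomZero C Y W \<cdot> f" using assms o by (simp add: Hom_def)
qed

section \<open>Zero objects, kernels and cokernels\<close>

lemma zero_object_iff:
  "is_zero_object C Z \<longleftrightarrow> Z \<in> Obj C \<and> Ident C Z = HomZero C Z Z"
proof safe
  assume z: "is_zero_object C Z"
  then show Z: "Z \<in> Obj C" by (simp add: is_zero_object_def)
  then show "Ident C Z = HomZero C Z Z"
    using z ident_closed[OF Z] zero_hom[OF Z Z] unfolding is_zero_object_def by blast
next
  assume Z: "Z \<in> Obj C" and e: "Ident C Z = HomZero C Z Z"
  \<comment> \<open>An arrow into or out of \<open>Z\<close> absorbs \<open>Ident C Z\<close>, hence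
    is a composite with a zero arrow.\<close>
  have "f = HomZero C X Z" if "f \<in> Hom C X Z" "X \<in> Obj C" for f X
    using that comp_ident(2)[of f Z] zero_comp[of f Z Z] e Z by (simp add: Hom_def)
  moreover have "f = HomZero C Z X" if "f \<in> Hom C Z X" "X \<in> Obj C" for f X
    using that comp_ident(1)[of f Z] comp_zero[of f Z Z] e Z by (simp add: Hom_def)
  ultimately show "is_zero_object C Z" unfolding is_zero_object_def using Z zero_hom by metis
qed

lemma zero_object_hom:
  assumes "is_zero_object C Z"
  shows "f \<in> Hom C X Z \<Longrightarrow> f = HomZero C X Z" "f \<in> Hom C Z X \<Longrightarrow> f = HomZero C Z X"
proof -
  have Z: "Z \<in> Obj C" using assms by (simp add: is_zero_object_def)
  show "f \<in> Hom C X Z \<Longrightarrow> f = HomZero C X Z"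
    using assms Hom_obj[of f X Z] zero_hom[of X Z] Z unfolding is_zero_object_def by blast
  show "f \<in> Hom C Z X \<Longrightarrow> f = HomZero C Z X"
    using assms Hom_obj[of f Z X] zero_hom[of Z X] Z unfolding is_zero_object_def by blast
qed

text \<open>Uniqueness of the factorisation is cancellation of the mono \<open>k\<close>, so only
  its existence is left as a premise.\<close>

lemma is_kernelI:
  assumes k: "k \<in> Hom C K A" and f: "f \<in> Hom C A B" and m: "is_mono C k"
    and z: "f \<cdot> k = HomZero C K B"
    and u: "\<And>W h. h \<in> Hom C W A \<Longrightarrow> f \<cdot> h = HomZero C W B \<Longrightarrow> \<exists>u. u \<in> Hom C W K \<and> k \<cdot> u = h"
  shows "is_kernel C k f"
  unfolding is_kernel_def
proof (intro conjI allI ballI impI)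
  fix W h assume "h \<in> Hom C W (Dom C f)" "f \<cdot> h = HomZero C W (Cod C f)"
  then have "h \<in> Hom C W A" "f \<cdot> h = HomZero C W B" using f by (simp_all add: Hom_def)
  from u[OF this] have "\<exists>!u. u \<in> Hom C W K \<and> k \<cdot> u = h" using mono_cancel[OF m k] by metis
  then show "\<exists>!u. u \<in> Hom C W (Dom C k) \<and> k \<cdot> u = h" using k by (simp add: Hom_def)
qed (use k f z in \<open>auto simp: Hom_def\<close>)

lemma is_cokernelI:
  assumes c: "c \<in> Hom C B D" and f: "f \<in> Hom C A B" and m: "is_epi C c"
    and z: "c \<cdot> f = HomZero C A D"
    and u: "\<And>W h. h \<in> Hom C B W \<Longrightarrow> h \<cdot> f = HomZero C A W \<Longrightarrow> \<exists>u. u \<in> Hom C D W \<and> u \<cdot> c = h"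
  shows "is_cokernel C c f"
  unfolding is_cokernel_def
proof (intro conjI allI ballI impI)
  fix W h assume "h \<in> Hom C (Cod C f) W" "h \<cdot> f = HomZero C (Dom C f) W"
  then have "h \<in> Hom C B W" "h \<cdot> f = HomZero C A W" using f by (simp_all add: Hom_def)
  from u[OF this] have "\<exists>!u. u \<in> Hom C D W \<and> u \<cdot> c = h" using epi_cancel[OF m c] by metis
  then show "\<exists>!u. u \<in> Hom C (Cod C c) W \<and> u \<cdot> c = h" using c by (simp add: Hom_def)
qed (use c f z in \<open>auto simp: Hom_def\<close>)

lemma kernel_comp: "is_kernel C k f \<Longrightarrow> k \<in> Hom C K A \<Longrightarrow> f \<in> Hom C A B \<Longrightarrow> f \<cdot> k = HomZero C K B"
  by (simp add: is_kernel_def Hom_def)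

lemma kernel_factor:
  assumes "is_kernel C k f" "k \<in> Hom C K A" "f \<in> Hom C A B" "h \<in> Hom C W A" "f \<cdot> h = HomZero C W B"
  obtains u where "u \<in> Hom C W K" "k \<cdot> u = h"
proof -
  have "h \<in> Hom C W (Dom C f)" "f \<cdot> h = HomZero C W (Cod C f)" "Dom C k = K"
    using assms by (simp_all add: Hom_def)
  then show thesis using assms(1) that unfolding is_kernel_def by blast
qed

text \<open>Both \<open>w\<close> and the zero arrow factor zero through \<open>k\<close>; the
  uniqueness clause of \<open>is_kernel\<close> identifies them.\<close>

lemma kernel_mono:
  assumes "is_kernel C k f" "k \<in> Hom C K A"
  shows "is_mono C k"
proof (rule is_monoI[OF assms(2)])
  fix W w assume w: "w \<in> Hom C W K" "k \<cdot> w = HomZero C W A"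
  have o: "W \<in> Obj C" "K \<in> Obj C" using Hom_obj w by blast+
  have f: "f \<in> Hom C A (Cod C f)" using assms by (simp add: is_kernel_def Hom_def)
  have "HomZero C W A \<in> Hom C W (Dom C f)" "f \<cdot> HomZero C W A = HomZero C W (Cod C f)"
    using f o Hom_obj[OF f] by (auto simp: Hom_def)
  moreover have "Dom C k = K" using assms(2) by (simp add: Hom_def)
  ultimately have "\<exists>!u. u \<in> Hom C W K \<and> k \<cdot> u = HomZero C W A"
    using assms(1) unfolding is_kernel_def by blast
  moreover have "HomZero C W K \<in> Hom C W K \<and> k \<cdot> HomZero C W K = HomZero C W A"
    using o assms(2) by (simp add: Hom_def)
  ultimately show "w = HomZero C W K" using w by blast
qed

lemma cokernel_comp:
  "is_cokernel C c f \<Longrightarrow> f \<in> Hom C A B \<Longrightarrow> c \<in> Hom C B D \<Longrightarrow> c \<cdot> f = HomZero C A D"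
  by (simp add: is_cokernel_def Hom_def)

lemma cokernel_factor:
  assumes "is_cokernel C c f" "c \<in> Hom C B D" "f \<in> Hom C A B" "h \<in> Hom C B W" "h \<cdot> f = HomZero C A W"
  obtains u where "u \<in> Hom C D W" "u \<cdot> c = h"
proof -
  have "h \<in> Hom C (Cod C f) W" "h \<cdot> f = HomZero C (Dom C f) W" "Cod C c = D"
    using assms by (simp_all add: Hom_def)
  then show thesis using assms(1) that unfolding is_cokernel_def by blast
qed

lemma cokernel_epi:
  assumes "is_cokernel C c f" "c \<in> Hom C B D"
  shows "is_epi C c"
proof (rule is_epiI[OF assms(2)])
  fix W w assume w: "w \<in> Hom C D W" "w \<cdot> c = HomZero C B W"
  have o: "W \<in> Obj C" "D \<in> Obj C" using Hom_obj w by blast+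
  have f: "f \<in> Hom C (Dom C f) B" using assms by (simp add: is_cokernel_def Hom_def)
  have "HomZero C B W \<in> Hom C (Cod C f) W" "HomZero C B W \<cdot> f = HomZero C (Dom C f) W"
    using f o Hom_obj[OF f] by (auto simp: Hom_def)
  moreover have "Cod C c = D" using assms(2) by (simp add: Hom_def)
  ultimately have "\<exists>!u. u \<in> Hom C D W \<and> u \<cdot> c = HomZero C B W"
    using assms(1) unfolding is_cokernel_def by blast
  moreover have "HomZero C D W \<in> Hom C D W \<and> HomZero C D W \<cdot> c = HomZero C B W"
    using o assms(2) by (simp add: Hom_def)
  ultimately show "w = HomZero C D W" using w by blast
qed

text \<open>Since \<open>g\<close> kills \<open>k\<close>, it factors as some \<open>v\<close> after
  \<open>c\<close>; whatever \<open>c\<close> kills is then killed by \<open>g\<close> and factors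
  through \<open>k\<close>. Together with \<open>mono_normal\<close> this makes every mono in an
  abelian category the kernel of its cokernel.\<close>

lemma kernel_of_its_cokernel:
  assumes k: "is_kernel C k g" "k \<in> Hom C K A" and c: "is_cokernel C c k" "c \<in> Hom C A D"
  shows "is_kernel C k c"
proof (rule is_kernelI[OF k(2) c(2) kernel_mono[OF k] cokernel_comp[OF c(1) k(2) c(2)]])
  fix W h assume h: "h \<in> Hom C W A" "c \<cdot> h = HomZero C W D"
  have g: "g \<in> Hom C A (Cod C g)" using k by (simp add: is_kernel_def Hom_def)
  obtain v where v: "v \<in> Hom C D (Cod C g)" "v \<cdot> c = g"
    using cokernel_factor[OF c k(2) g kernel_comp[OF k g]] .
  have "g \<cdot> h = v \<cdot> (c \<cdot> h)" using v h c(2) by (auto simp: Hom_def)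
  also have "\<dots> = HomZero C W (Cod C g)" using h v Hom_obj[OF h(1)] by (simp add: Hom_def)
  finally show "\<exists>u. u \<in> Hom C W K \<and> k \<cdot> u = h" using kernel_factor[OF k g h(1)] by metis
qed

lemma cokernel_of_its_kernel:
  assumes c: "is_cokernel C c f" "c \<in> Hom C A D" and k: "is_kernel C k c" "k \<in> Hom C K A"
  shows "is_cokernel C c k"
proof (rule is_cokernelI[OF c(2) k(2) cokernel_epi[OF c] kernel_comp[OF k c(2)]])
  fix W h assume h: "h \<in> Hom C A W" "h \<cdot> k = HomZero C K W"
  have f: "f \<in> Hom C (Dom C f) A" using c by (simp add: is_cokernel_def Hom_def)
  obtain v where v: "v \<in> Hom C (Dom C f) K" "k \<cdot> v = f"
    using kernel_factor[OF k c(2) f cokernel_comp[OF c(1) f c(2)]] .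
  have "h \<cdot> f = (h \<cdot> k) \<cdot> v" using v h(1) k(2) by (auto simp: Hom_def)
  also have "\<dots> = HomZero C (Dom C f) W" using h v Hom_obj[OF h(1)] by (simp add: Hom_def)
  finally show "\<exists>u. u \<in> Hom C D W \<and> u \<cdot> c = h" using cokernel_factor[OF c f h(1)] by metis
qed

section \<open>Biproducts as a calculus of rows and columns\<close>

lemma biproduct_swap:
  assumes "is_biproduct C A B S iA iB pA pB"
  shows "is_biproduct C B A S iB iA pB pA"
proof -
  have "iA \<cdot> pA \<in> Hom C S S" "iB \<cdot> pB \<in> Hom C S S"
    using assms comp_closed unfolding is_biproduct_def by blast+
  then have "HomAdd C (iB \<cdot> pB) (iA \<cdot> pA) = HomAdd C (iA \<cdot> pA) (iB \<cdot> pB)"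
    using add_comm by blast
  then show ?thesis using assms by (simp add: is_biproduct_def)
qed

lemma biproduct_expand_right:
  assumes b: "is_biproduct C A B S iA iB pA pB" and h: "h \<in> Hom C S W"
  shows "h = HomAdd C (h \<cdot> (iA \<cdot> pA)) (h \<cdot> (iB \<cdot> pB))"
  using comp_add[of "iA \<cdot> pA" "iB \<cdot> pB" h] b h by (simp add: is_biproduct_def Hom_def)

lemma biproduct_expand_left:
  assumes b: "is_biproduct C A B S iA iB pA pB" and h: "h \<in> Hom C W S"
  shows "h = HomAdd C (iA \<cdot> (pA \<cdot> h)) (iB \<cdot> (pB \<cdot> h))"
  using add_comp[of h "iA \<cdot> pA" "iB \<cdot> pB"] b h by (simp add: is_biproduct_def Hom_def)

lemma biproduct_zero_out:
  assumes b: "is_biproduct C A B S iA iB pA pB" and h: "h \<in> Hom C S W"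
    and z: "h \<cdot> iA = HomZero C A W" "h \<cdot> iB = HomZero C B W"
  shows "h = HomZero C S W"
proof -
  have o: "S \<in> Obj C" "W \<in> Obj C" using Hom_obj h by blast+
  have "h \<cdot> (iA \<cdot> pA) = (h \<cdot> iA) \<cdot> pA" "h \<cdot> (iB \<cdot> pB) = (h \<cdot> iB) \<cdot> pB"
    using b h unfolding is_biproduct_def Hom_def by auto
  then have "h \<cdot> (iA \<cdot> pA) = HomZero C S W" "h \<cdot> (iB \<cdot> pB) = HomZero C S W"
    using z b o unfolding is_biproduct_def Hom_def by auto
  then show ?thesis using biproduct_expand_right[OF b h] add_zero_left[OF zero_hom[OF o]] by simp
qed

lemma biproduct_zero_in:
  assumes b: "is_biproduct C A B S iA iB pA pB" and h: "h \<in> Hom C W S"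
    and z: "pA \<cdot> h = HomZero C W A" "pB \<cdot> h = HomZero C W B"
  shows "h = HomZero C W S"
proof -
  have o: "W \<in> Obj C" "S \<in> Obj C" using Hom_obj h by blast+
  have "iA \<cdot> (pA \<cdot> h) = HomZero C W S" "iB \<cdot> (pB \<cdot> h) = HomZero C W S"
    using z b o unfolding is_biproduct_def Hom_def by auto
  then show ?thesis using biproduct_expand_left[OF b h] add_zero_left[OF zero_hom[OF o]] by simp
qed

lemma biproduct_pairing:
  assumes b: "is_biproduct C A B S iA iB pA pB" and f: "f \<in> Hom C W A" and g: "g \<in> Hom C W B"
  obtains h where "h \<in> Hom C W S" "pA \<cdot> h = f" "pB \<cdot> h = g"
proof -
  have m: "iA \<in> Hom C A S" "iB \<in> Hom C B S" "pA \<in> Hom C S A" "pB \<in> Hom C S B"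
    and e: "pA \<cdot> iA = Ident C A" "pB \<cdot> iB = Ident C B" "pB \<cdot> iA = HomZero C A B" "pA \<cdot> iB = HomZero C B A"
    and o: "A \<in> Obj C" "B \<in> Obj C" "W \<in> Obj C"
    using b Hom_obj[OF f] by (auto simp: is_biproduct_def)
  let ?h = "HomAdd C (iA \<cdot> f) (iB \<cdot> g)"
  have h: "?h \<in> Hom C W S" by (rule add_hom[OF comp_closed[OF f m(1)] comp_closed[OF g m(2)]])
  have "pA \<cdot> ?h = HomAdd C (pA \<cdot> (iA \<cdot> f)) (pA \<cdot> (iB \<cdot> g))"
    using m f g by (simp add: Hom_def comp_add)
  also have "\<dots> = HomAdd C ((pA \<cdot> iA) \<cdot> f) (HomZero C W A)"
    using comp_assoc[OF f m(1,3)] comp_comp_zero[OF m(2,3) e(4) g] by simp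
  also have "\<dots> = f" using e f add_zero_right[OF f] by (simp add: Hom_def)
  finally have 1: "pA \<cdot> ?h = f" .
  have "pB \<cdot> ?h = HomAdd C (pB \<cdot> (iA \<cdot> f)) (pB \<cdot> (iB \<cdot> g))"
    using m f g by (simp add: Hom_def comp_add)
  also have "\<dots> = HomAdd C (HomZero C W B) ((pB \<cdot> iB) \<cdot> g)"
    using comp_assoc[OF g m(2,4)] comp_comp_zero[OF m(1,4) e(3) f] by simp
  also have "\<dots> = g" using e g add_zero_left[OF g] by (simp add: Hom_def)
  finally show thesis using that[OF h 1] by blast
qed

lemma biproduct_copairing:
  assumes b: "is_biproduct C A B S iA iB pA pB" and f: "f \<in> Hom C A W" and g: "g \<in> Hom C B W"
  obtains h where "h \<in> Hom C S W" "h \<cdot> iA = f" "h \<cdot> iB = g"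
proof -
  have m: "iA \<in> Hom C A S" "iB \<in> Hom C B S" "pA \<in> Hom C S A" "pB \<in> Hom C S B"
    and e: "pA \<cdot> iA = Ident C A" "pB \<cdot> iB = Ident C B" "pB \<cdot> iA = HomZero C A B" "pA \<cdot> iB = HomZero C B A"
    and o: "A \<in> Obj C" "B \<in> Obj C" "W \<in> Obj C"
    using b Hom_obj[OF f] by (auto simp: is_biproduct_def)
  let ?h = "HomAdd C (f \<cdot> pA) (g \<cdot> pB)"
  have h: "?h \<in> Hom C S W" by (rule add_hom[OF comp_closed[OF m(3) f] comp_closed[OF m(4) g]])
  have "?h \<cdot> iA = HomAdd C (f \<cdot> (pA \<cdot> iA)) (g \<cdot> (pB \<cdot> iA))"
    using m f g by (simp add: Hom_def add_comp)
  also have "\<dots> = f" using e f g o add_zero_right[OF f] by (simp add: Hom_def)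
  finally have 1: "?h \<cdot> iA = f" .
  have "?h \<cdot> iB = HomAdd C (f \<cdot> (pA \<cdot> iB)) (g \<cdot> (pB \<cdot> iB))"
    using m f g by (simp add: Hom_def add_comp)
  also have "\<dots> = g" using e f g o add_zero_left[OF g] by (simp add: Hom_def)
  finally show thesis using that[OF h 1] by blast
qed

text \<open>The product of a row matrix with a column matrix: \<open>iA\<close>, \<open>iB\<close>
  cut \<open>t\<close> into its row and \<open>pA\<close>, \<open>pB\<close> cut \<open>h\<close>
  into its column.\<close>

lemma biproduct_comp:
  assumes b: "is_biproduct C A B S iA iB pA pB" and h: "h \<in> Hom C W S" and t: "t \<in> Hom C S V"
  shows "t \<cdot> h = HomAdd C ((t \<cdot> iA) \<cdot> (pA \<cdot> h)) ((t \<cdot> iB) \<cdot> (pB \<cdot> h))"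
proof -
  have m: "iA \<in> Hom C A S" "iB \<in> Hom C B S" "pA \<in> Hom C S A" "pB \<in> Hom C S B"
    using b by (auto simp: is_biproduct_def)
  have "t \<cdot> h = t \<cdot> HomAdd C (iA \<cdot> (pA \<cdot> h)) (iB \<cdot> (pB \<cdot> h))"
    using biproduct_expand_left[OF b h] by simp
  then show ?thesis using m h t by (simp add: Hom_def comp_add)
qed

lemma biproduct_eq_out:
  assumes b: "is_biproduct C A B S iA iB pA pB" and t: "t \<in> Hom C S V" and u: "u \<in> Hom C S V"
    and e: "t \<cdot> iA = u \<cdot> iA" "t \<cdot> iB = u \<cdot> iB"
  shows "t = u"
proof -
  have i: "Ident C S \<in> Hom C S S" using b ident_closed by (simp add: is_biproduct_def)
  have "t \<cdot> Ident C S = u \<cdot> Ident C S"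
    using biproduct_comp[OF b i t] biproduct_comp[OF b i u] e by simp
  then show ?thesis using t u by (simp add: Hom_def)
qed

section \<open>Finite direct sums and local endomorphism rings\<close>

lemma end_ring_abelian_monoid:
  assumes "S \<in> Obj C"
  shows "abelian_monoid (end_ring C S)"
proof (rule abelian_monoidI)
qed (use assms in \<open>auto simp: end_ring_def add_hom add_zero_left add_assoc intro: add_comm\<close>)

text \<open>Composing \<open>h\<close> with the identity, written as the sum of all
  \<open>i k \<cdot> p k\<close>, gives a sum of zeros. This is the only form in which the sum
  formula of \<open>is_direct_sum\<close> enters the induction on decompositions.\<close>

lemma direct_sum_jointly_epic:
  assumes d: "is_direct_sum C n A S i p" and h: "h \<in> Hom C S W"
    and z: "\<And>k. k < n \<Longrightarrow> h \<cdot> i k = HomZero C (A k) W"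
  shows "h = HomZero C S W"
proof -
  have S: "S \<in> Obj C" and W: "W \<in> Obj C" using Hom_obj h by blast+
  interpret M: abelian_monoid "end_ring C S" using end_ring_abelian_monoid[OF S] .
  have ip: "i k \<in> Hom C (A k) S" "p k \<in> Hom C S (A k)" "i k \<cdot> p k \<in> Hom C S S" if "k < n" for k
    using d that comp_closed unfolding is_direct_sum_def by blast+
  \<comment> \<open>Partial sums over subsets of the index set; membership in
    \<open>Hom C S S\<close> is carried along because distributivity asks for it.\<close>
  have "F \<subseteq> {..<n} \<Longrightarrow> (\<Oplus>\<^bsub>end_ring C S\<^esub>k\<in>F. i k \<cdot> p k) \<in> Hom C S S \<and>
      h \<cdot> (\<Oplus>\<^bsub>end_ring C S\<^esub>k\<in>F. i k \<cdot> p k) = HomZero C S W" if "finite F" for F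
    using that
  proof induction
    case empty
    then show ?case using h S by (simp add: M.finsum_empty) (simp add: end_ring_def Hom_def)
  next
    case (insert k F)
    let ?s = "\<Oplus>\<^bsub>end_ring C S\<^esub>k\<in>F. i k \<cdot> p k"
    have k: "k < n" and s: "?s \<in> Hom C S S" "h \<cdot> ?s = HomZero C S W" using insert by auto
    have "(\<lambda>k. i k \<cdot> p k) \<in> insert k F \<rightarrow> carrier (end_ring C S)"
      using insert.prems ip(3) by (auto simp: end_ring_def)
    then have e: "(\<Oplus>\<^bsub>end_ring C S\<^esub>k\<in>insert k F. i k \<cdot> p k) = HomAdd C (i k \<cdot> p k) ?s"
      using M.finsum_insert[OF insert.hyps] by (simp add: end_ring_def)
    have "h \<cdot> (i k \<cdot> p k) = (h \<cdot> i k) \<cdot> p k" using h ip[OF k] by (simp add: Hom_def)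
    also have "\<dots> = HomZero C S W" using z[OF k] ip[OF k] W by (simp add: Hom_def)
    finally have "h \<cdot> HomAdd C (i k \<cdot> p k) ?s = HomZero C S W"
      using comp_add[of "i k \<cdot> p k" ?s h] h ip[OF k] s S W
      by (simp add: Hom_def add_zero_left[OF zero_hom])
    then show ?case using e add_hom[OF ip(3)[OF k] s(1)] by simp
  qed
  from this[of "{..<n}"] have "h \<cdot> Ident C S = HomZero C S W"
    using d by (simp add: is_direct_sum_def)
  then show ?thesis using h by (simp add: Hom_def)
qed

text \<open>The idempotents \<open>iA \<cdot> pA\<close> and \<open>iB \<cdot> pB\<close> add up to
  the identity, so locality makes one of them a unit. If it is the first, \<open>pB\<close> kills it
  and hence vanishes, which makes the identity of \<open>B\<close> zero.\<close>

lemma local_end_indecomposable: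
  assumes X: "X \<in> Obj C" and l: "local_ring (end_ring C X)"
  shows "indecomposable C X"
  unfolding indecomposable_def
proof (intro conjI allI impI)
  show "X \<in> Obj C" by (rule X)
  show "\<not> is_zero_object C X"
    using l unfolding zero_object_iff local_ring_def end_ring_def by simp
next
  have *: "is_zero_object C B" if b: "is_biproduct C A B X iA iB pA pB"
    and u: "iA \<cdot> pA \<in> Units (end_ring C X)" for A B iA iB pA pB
  proof -
    obtain v where v: "v \<in> Hom C X X" "(iA \<cdot> pA) \<cdot> v = Ident C X"
      using u unfolding Units_def end_ring_def by auto
    have o: "A \<in> Obj C" "B \<in> Obj C" using b by (auto simp: is_biproduct_def)
    have m: "iA \<in> Hom C A X" "pA \<in> Hom C X A" "pB \<in> Hom C X B"
      using b by (auto simp: is_biproduct_def)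
    have "pB = pB \<cdot> ((iA \<cdot> pA) \<cdot> v)" using v b by (simp add: is_biproduct_def Hom_def)
    also have "\<dots> = pB \<cdot> (iA \<cdot> (pA \<cdot> v))" using comp_assoc[OF v(1) m(2,1)] by simp
    also have "\<dots> = (pB \<cdot> iA) \<cdot> (pA \<cdot> v)"
      by (rule comp_assoc[OF comp_closed[OF v(1) m(2)] m(1,3), symmetric])
    also have "\<dots> = HomZero C A B \<cdot> (pA \<cdot> v)" using b by (simp add: is_biproduct_def)
    also have "\<dots> = HomZero C X B" using b v(1) by (simp add: is_biproduct_def Hom_def)
    finally have "Ident C B = HomZero C X B \<cdot> iB" using b by (simp add: is_biproduct_def)
    then have "Ident C B = HomZero C B B" using b by (simp add: is_biproduct_def Hom_def)
    then show ?thesis using o by (simp add: zero_object_iff)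
  qed
  fix A B iA iB pA pB assume b: "is_biproduct C A B X iA iB pA pB"
  interpret E: ring "end_ring C X" using l by (simp add: local_ring_def)
  have "iA \<cdot> pA \<in> carrier (end_ring C X)" "iB \<cdot> pB \<in> carrier (end_ring C X)"
    using b by (auto simp: end_ring_def is_biproduct_def Hom_def)
  moreover have "(iA \<cdot> pA) \<oplus>\<^bsub>end_ring C X\<^esub> (iB \<cdot> pB) \<in> Units (end_ring C X)"
    using b E.Units_one_closed by (simp add: end_ring_def is_biproduct_def)
  ultimately have "iA \<cdot> pA \<in> Units (end_ring C X) \<or> iB \<cdot> pB \<in> Units (end_ring C X)"
    using l unfolding local_ring_def by blast
  then show "is_zero_object C A \<or> is_zero_object C B" using *[OF b] *[OF biproduct_swap[OF b]] by blast
qed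

lemma biproduct_direct_sum:
  assumes b: "is_biproduct C A B S iA iB pA pB"
  shows "is_direct_sum C 2 (\<lambda>k. if k = 0 then A else B) S
    (\<lambda>k. if k = 0 then iA else iB) (\<lambda>k. if k = 0 then pA else pB)"
proof -
  have S: "S \<in> Obj C" using b by (simp add: is_biproduct_def)
  interpret M: abelian_monoid "end_ring C S" using end_ring_abelian_monoid[OF S] .
  have c: "iA \<cdot> pA \<in> carrier (end_ring C S)" "iB \<cdot> pB \<in> carrier (end_ring C S)"
    using b by (auto simp: end_ring_def is_biproduct_def Hom_def)
  have "{..<2::nat} = {0, 1}" by auto
  moreover have "(\<Oplus>\<^bsub>end_ring C S\<^esub>k\<in>{0::nat,1}. (if k = 0 then iA else iB) \<cdot> (if k = 0 then pA else pB))
      = (iA \<cdot> pA) \<oplus>\<^bsub>end_ring C S\<^esub> (iB \<cdot> pB)"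
    using c by (simp add: M.finsum_insert)
  ultimately show ?thesis using b S
    by (auto simp: is_direct_sum_def is_biproduct_def less_2_cases_iff end_ring_def)
qed

text \<open>Bridges two encodings in \<open>additive_subcategory\<close>: closure under sums is
  stated for families indexed by numbers, and closure under summands names only the left summand, so
  the right one is reached by swapping.\<close>

lemma additive_subcategory_biproduct:
  assumes a: "additive_subcategory C R" and b: "is_biproduct C A B S iA iB pA pB"
  shows "S \<in> R \<longleftrightarrow> A \<in> R \<and> B \<in> R"
proof
  assume "S \<in> R"
  then show "A \<in> R \<and> B \<in> R"
    using a b biproduct_swap[OF b] unfolding additive_subcategory_def by blast
next
  assume "A \<in> R \<and> B \<in> R"
  then have "\<forall>k<2::nat. (if k = 0 then A else B) \<in> R" by simp
  moreover have "\<And>n A S i p. is_direct_sum C n A S i p \<Longrightarrow> \<forall>k<n. A k \<in> R \<Longrightarrow> S \<in> R"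
    using a unfolding additive_subcategory_def by blast
  ultimately show "S \<in> R" using biproduct_direct_sum[OF b] by blast
qed

end

section \<open>Short exact sequences through kernels and epimorphisms\<close>

context abelian_category
begin

text \<open>Unpacks exactness, stated through images, into the data used from here on:
  \<open>f\<close> is a kernel of \<open>g\<close>, and \<open>g\<close> is epi.\<close>

lemma short_exactD:
  assumes "short_exact C X f E g Y"
  shows "f \<in> Hom C X E" "g \<in> Hom C E Y" "is_kernel C f g" "is_epi C g"
proof -
  show f: "f \<in> Hom C X E" and g: "g \<in> Hom C E Y"
    using assms by (simp_all add: short_exact_def)
  have o: "X \<in> Obj C" "E \<in> Obj C" "Y \<in> Obj C" using Hom_obj f g by blast+
  obtain Z where Z: "is_zero_object C Z"
    and e: "exact_at C (HomZero C Z X) f" "exact_at C f g" "exact_at C g (HomZero C Y Z)"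
    using assms unfolding short_exact_def by blast
  have oZ: "Z \<in> Obj C" using Z by (simp add: is_zero_object_def)
  have mono: "is_mono C f"
  proof (rule is_monoI[OF f])
    fix W w assume w: "w \<in> Hom C W X" "f \<cdot> w = HomZero C W E"
    \<comment> \<open>\<open>m\<close> is both the image of the zero arrow and the kernel of
      \<open>f\<close>. The cokernel \<open>c\<close> of a zero arrow has a left inverse
      \<open>v\<close>, so whatever factors through \<open>m\<close>, being killed by
      \<open>c\<close>, is zero.\<close>
    obtain m c where c: "is_cokernel C c (HomZero C Z X)" and m: "is_kernel C m c" "is_kernel C m f"
      using e(1) unfolding exact_at_def is_image_def by blast
    have ch: "c \<in> Hom C X (Cod C c)" using c o oZ by (simp add: is_cokernel_def Hom_def)
    have mh: "m \<in> Hom C (Dom C m) X" using m f by (simp add: is_kernel_def Hom_def)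
    have "Ident C X \<cdot> HomZero C Z X = HomZero C Z X" using o oZ by simp
    then obtain v where v: "v \<in> Hom C (Cod C c) X" "v \<cdot> c = Ident C X"
      using cokernel_factor[OF c ch zero_hom[OF oZ o(1)] ident_closed[OF o(1)]] by blast
    obtain u where u: "u \<in> Hom C W (Dom C m)" "m \<cdot> u = w"
      using kernel_factor[OF m(2) mh f w] .
    have "w = (v \<cdot> c) \<cdot> w" using v w by (simp add: Hom_def)
    also have "\<dots> = v \<cdot> (c \<cdot> (m \<cdot> u))" using comp_assoc[OF w(1) ch v(1)] u by simp
    also have "\<dots> = v \<cdot> HomZero C W (Cod C c)"
      using comp_comp_zero[OF mh ch kernel_comp[OF m(1) mh ch] u(1)] by simp
    also have "\<dots> = HomZero C W X" using v Hom_obj[OF w(1)] by (simp add: Hom_def)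
    finally show "w = HomZero C W X" .
  qed
  show "is_kernel C f g"
  proof -
    obtain m c where c: "is_cokernel C c f" and m: "is_kernel C m c" "is_kernel C m g"
      using e(2) unfolding exact_at_def is_image_def by blast
    obtain g' where "is_kernel C f g'" using mono_normal[OF mono] by blast
    moreover have ch: "c \<in> Hom C E (Cod C c)" using c f by (simp add: is_cokernel_def Hom_def)
    \<comment> \<open>The mono \<open>f\<close> is thus a kernel of \<open>c\<close>, as is
      \<open>m\<close>; each factors through the other, which carries the kernel property for
      \<open>g\<close> from \<open>m\<close> to \<open>f\<close>.\<close>
    ultimately have fc: "is_kernel C f c" using kernel_of_its_cokernel[OF _ f c] by blast
    have mh: "m \<in> Hom C (Dom C m) E" using m g by (simp add: is_kernel_def Hom_def)
    show ?thesis
    proof (rule is_kernelI[OF f g mono])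
      obtain u where u: "u \<in> Hom C X (Dom C m)" "m \<cdot> u = f"
        using kernel_factor[OF m(1) mh ch f kernel_comp[OF fc f ch]] .
      show "g \<cdot> f = HomZero C X Y"
        using comp_comp_zero[OF mh g kernel_comp[OF m(2) mh g] u(1)] u by simp
    next
      fix W h assume h: "h \<in> Hom C W E" "g \<cdot> h = HomZero C W Y"
      obtain u where u: "u \<in> Hom C W (Dom C m)" "m \<cdot> u = h"
        using kernel_factor[OF m(2) mh g h] .
      have "c \<cdot> h = HomZero C W (Cod C c)"
        using comp_comp_zero[OF mh ch kernel_comp[OF m(1) mh ch] u(1)] u by simp
      then show "\<exists>u. u \<in> Hom C W X \<and> f \<cdot> u = h" using kernel_factor[OF fc f ch h(1)] by metis
    qed
  qed
  show "is_epi C g"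
  proof (rule is_epiI[OF g])
    fix W w assume w: "w \<in> Hom C Y W" "w \<cdot> g = HomZero C E W"
    \<comment> \<open>As the kernel of a zero arrow, \<open>m\<close> has a right inverse
      \<open>v\<close>. Since \<open>c\<close> kills \<open>m\<close>, it is zero, and so is every
      arrow that factors through it.\<close>
    obtain m c where c: "is_cokernel C c g" and m: "is_kernel C m c" "is_kernel C m (HomZero C Y Z)"
      using e(3) unfolding exact_at_def is_image_def by blast
    have ch: "c \<in> Hom C Y (Cod C c)" using c g by (simp add: is_cokernel_def Hom_def)
    have mh: "m \<in> Hom C (Dom C m) Y" using m o oZ by (simp add: is_kernel_def Hom_def)
    have "HomZero C Y Z \<cdot> Ident C Y = HomZero C Y Z" using o oZ by simp
    then obtain v where v: "v \<in> Hom C Y (Dom C m)" "m \<cdot> v = Ident C Y"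
      using kernel_factor[OF m(2) mh zero_hom[OF o(3) oZ] ident_closed[OF o(3)]] by blast
    obtain u where u: "u \<in> Hom C (Cod C c) W" "u \<cdot> c = w"
      using cokernel_factor[OF c ch g w] .
    have "c = c \<cdot> (m \<cdot> v)" using v ch by (simp add: Hom_def)
    also have "\<dots> = HomZero C Y (Cod C c)"
      by (rule comp_comp_zero[OF mh ch kernel_comp[OF m(1) mh ch] v(1)])
    finally have "w = u \<cdot> HomZero C Y (Cod C c)" using u by simp
    also have "\<dots> = HomZero C Y W" using u o by (simp add: Hom_def)
    finally show "w = HomZero C Y W" .
  qed
qed

text \<open>The end terms need explicit images. The zero arrow into \<open>X\<close> is its own
  image, with cokernel \<open>Ident C X\<close>; the image of \<open>g\<close> is
  \<open>Ident C Y\<close>, with cokernel the zero arrow out of \<open>Y\<close>.\<close>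

lemma short_exactI:
  assumes f: "f \<in> Hom C X E" and g: "g \<in> Hom C E Y" and k: "is_kernel C f g" and e: "is_epi C g"
  shows "short_exact C X f E g Y"
proof -
  obtain Z where Z: "is_zero_object C Z" using zero_object by blast
  have oZ: "Z \<in> Obj C" using Z by (simp add: is_zero_object_def)
  have o: "X \<in> Obj C" "E \<in> Obj C" "Y \<in> Obj C" using Hom_obj f g by blast+
  have mono: "is_mono C f" using kernel_mono[OF k f] .
  have zm: "is_mono C (HomZero C Z X)"
    by (rule is_monoI[OF zero_hom[OF oZ o(1)]]) (rule zero_object_hom(1)[OF Z])
  have ze: "is_epi C (HomZero C Y Z)"
    by (rule is_epiI[OF zero_hom[OF o(3) oZ]]) (rule zero_object_hom(2)[OF Z])
  have kz: "is_kernel C (HomZero C Z X) a" if a: "a \<in> Hom C X B" and "is_mono C a" for a B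
  proof (rule is_kernelI[OF zero_hom[OF oZ o(1)] a zm])
    show "a \<cdot> HomZero C Z X = HomZero C Z B" using a oZ by (simp add: Hom_def)
    fix W h assume h: "h \<in> Hom C W X" "a \<cdot> h = HomZero C W B"
    have "h = HomZero C W X" using mono_zero[OF that(2) a h] .
    moreover have "W \<in> Obj C" using Hom_obj[OF h(1)] by blast
    ultimately have "HomZero C W Z \<in> Hom C W Z \<and> HomZero C Z X \<cdot> HomZero C W Z = h"
      using o oZ by simp
    then show "\<exists>u. u \<in> Hom C W Z \<and> HomZero C Z X \<cdot> u = h" by blast
  qed
  have "is_epi C (Ident C X)"
    by (rule is_epiI[OF ident_closed[OF o(1)]]) (simp add: Hom_def)
  then have "is_cokernel C (Ident C X) (HomZero C Z X)"
  proof (rule is_cokernelI[OF ident_closed[OF o(1)] zero_hom[OF oZ o(1)]])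
    show "Ident C X \<cdot> HomZero C Z X = HomZero C Z X" using o oZ by simp
    fix W h assume h: "h \<in> Hom C X W"
    then have "h \<cdot> Ident C X = h" by (simp add: Hom_def)
    then show "\<exists>u. u \<in> Hom C X W \<and> u \<cdot> Ident C X = h" using h by blast
  qed
  moreover have "is_mono C (Ident C X)"
    by (rule is_monoI[OF ident_closed[OF o(1)]]) (simp add: Hom_def)
  ultimately have 1: "exact_at C (HomZero C Z X) f"
    unfolding exact_at_def is_image_def using kz[OF f mono] kz[OF ident_closed[OF o(1)]] by blast
  obtain c where c: "is_cokernel C c f" using cokernels f unfolding Hom_def by blast
  then have ch: "c \<in> Hom C E (Cod C c)" using f by (simp add: is_cokernel_def Hom_def)
  have 2: "exact_at C f g"
    unfolding exact_at_def is_image_def using c k kernel_of_its_cokernel[OF k f c ch] by blast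
  have "is_cokernel C (HomZero C Y Z) g"
  proof (rule is_cokernelI[OF zero_hom[OF o(3) oZ] g ze])
    show "HomZero C Y Z \<cdot> g = HomZero C E Z" using g oZ by (simp add: Hom_def)
    fix W h assume h: "h \<in> Hom C Y W" "h \<cdot> g = HomZero C E W"
    have "h = HomZero C Y W" using epi_zero[OF e g h] .
    moreover have "W \<in> Obj C" using Hom_obj[OF h(1)] by blast
    ultimately have "HomZero C Z W \<in> Hom C Z W \<and> HomZero C Z W \<cdot> HomZero C Y Z = h"
      using o oZ by simp
    then show "\<exists>u. u \<in> Hom C Z W \<and> u \<cdot> HomZero C Y Z = h" by blast
  qed
  moreover have "is_kernel C (Ident C Y) (HomZero C Y Z)"
  proof (rule is_kernelI[OF ident_closed[OF o(3)] zero_hom[OF o(3) oZ]])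
    show "is_mono C (Ident C Y)"
      by (rule is_monoI[OF ident_closed[OF o(3)]]) (simp add: Hom_def)
    show "HomZero C Y Z \<cdot> Ident C Y = HomZero C Y Z" using o oZ by simp
    fix W h assume h: "h \<in> Hom C W Y"
    then have "Ident C Y \<cdot> h = h" by (simp add: Hom_def)
    then show "\<exists>u. u \<in> Hom C W Y \<and> Ident C Y \<cdot> u = h" using h by blast
  qed
  ultimately have 3: "exact_at C g (HomZero C Y Z)"
    unfolding exact_at_def is_image_def by blast
  show ?thesis unfolding short_exact_def using f g Z 1 2 3 by blast
qed

lemma short_exact_cokernel:
  assumes "short_exact C X f E g Y"
  shows "is_cokernel C g f"
proof -
  note s = short_exactD[OF assms]
  obtain f' where "is_cokernel C g f'" using epi_normal[OF s(4)] by blast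
  from cokernel_of_its_kernel[OF this s(2,3,1)] show ?thesis .
qed

lemma short_exact_of_mono:
  assumes f: "f \<in> Hom C X E" and g: "g \<in> Hom C E Y" and m: "is_mono C f" and c: "is_cokernel C g f"
  shows "short_exact C X f E g Y"
proof -
  obtain h where "is_kernel C f h" using mono_normal[OF m] by blast
  from kernel_of_its_cokernel[OF this f c g] show ?thesis
    using short_exactI[OF f g _ cokernel_epi[OF c g]] by blast
qed

lemma kernel_exists:
  assumes "f \<in> Hom C A B"
  obtains K k where "k \<in> Hom C K A" "is_kernel C k f"
proof -
  obtain k where k: "is_kernel C k f" using kernels assms unfolding Hom_def by blast
  moreover have "k \<in> Hom C (Dom C k) A" using k assms by (simp add: is_kernel_def Hom_def)
  ultimately show thesis using that by blast
qed

lemma cokernel_exists: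
  assumes "f \<in> Hom C A B"
  obtains D c where "c \<in> Hom C B D" "is_cokernel C c f"
proof -
  obtain c where c: "is_cokernel C c f" using cokernels assms unfolding Hom_def by blast
  moreover have "c \<in> Hom C B (Cod C c)" using c assms by (simp add: is_cokernel_def Hom_def)
  ultimately show thesis using that by blast
qed

text \<open>The complement of \<open>P\<close> is the kernel of \<open>g\<close>: the arrow
  \<open>?e\<close>, which is 1 - s g, is killed by \<open>g\<close> and so factors as
  \<open>k \<cdot> r\<close>, and this \<open>r\<close> is the second projection. The equations for
  \<open>r\<close> are checked after composing with the mono \<open>k\<close>.\<close>

lemma split_epi_biproduct:
  assumes s: "s \<in> Hom C P G" and g: "g \<in> Hom C G P" and gs: "g \<cdot> s = Ident C P"
  obtains K k r where "is_biproduct C P K G s k g r"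
proof -
  have o: "P \<in> Obj C" "G \<in> Obj C" using Hom_obj[OF s] by auto
  obtain K k where k: "k \<in> Hom C K G" "is_kernel C k g" using kernel_exists[OF g] .
  have oK: "K \<in> Obj C" using Hom_obj[OF k(1)] by auto
  have gk: "g \<cdot> k = HomZero C K P" using kernel_comp[OF k(2,1) g] .
  have mono: "is_mono C k" using kernel_mono[OF k(2,1)] .
  have sg: "s \<cdot> g \<in> Hom C G G" using comp_closed[OF g s] .
  let ?e = "HomAdd C (Ident C G) (neg (s \<cdot> g))"
  have eh: "?e \<in> Hom C G G" using add_hom[OF ident_closed[OF o(2)] neg_hom[OF sg]] .
  have comp_e: "a \<cdot> ?e = HomAdd C a (neg (a \<cdot> (s \<cdot> g)))" if "a \<in> Hom C G W" for a W
    using that sg o comp_add[of "Ident C G" "neg (s \<cdot> g)" a] comp_neg[of "s \<cdot> g" a]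
    by (simp add: Hom_def)
  have e_comp: "?e \<cdot> a = HomAdd C a (neg (s \<cdot> (g \<cdot> a)))" if "a \<in> Hom C W G" for a W
    using that sg o g s add_comp[of a "Ident C G" "neg (s \<cdot> g)"] neg_comp[of a "s \<cdot> g"]
    by (simp add: Hom_def)
  have "g \<cdot> (s \<cdot> g) = g" using comp_assoc[OF g s g] gs g by (simp add: Hom_def)
  then have "g \<cdot> ?e = HomZero C G P" using comp_e[OF g] add_neg(1)[OF g] by simp
  then obtain r where r: "r \<in> Hom C G K" "k \<cdot> r = ?e" using kernel_factor[OF k(2,1) g eh] by blast
  have "k \<cdot> (r \<cdot> k) = (k \<cdot> r) \<cdot> k" using comp_assoc[OF k(1) r(1) k(1)] by simp
  also have "\<dots> = HomAdd C k (neg (s \<cdot> HomZero C K P))" using e_comp[OF k(1)] r(2) gk by simp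
  also have "\<dots> = k \<cdot> Ident C K"
    using k(1) s oK o neg_zero add_zero_right[OF k(1)] by (simp add: Hom_def)
  finally have rk: "r \<cdot> k = Ident C K"
    using mono_cancel[OF mono k(1) comp_closed[OF k(1) r(1)] ident_closed[OF oK]] by simp
  have "k \<cdot> (r \<cdot> s) = (k \<cdot> r) \<cdot> s" using comp_assoc[OF s r(1) k(1)] by simp
  also have "\<dots> = HomAdd C s (neg s)" using e_comp[OF s] r(2) gs s by (simp add: Hom_def)
  also have "\<dots> = HomZero C P G" using add_neg(1)[OF s] .
  finally have rs: "r \<cdot> s = HomZero C P K"
    using mono_zero[OF mono k(1) comp_closed[OF s r(1)]] by simp
  have "HomAdd C (s \<cdot> g) (k \<cdot> r) = HomAdd C ?e (s \<cdot> g)" using add_comm[OF sg eh] r(2) by simp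
  also have "\<dots> = HomAdd C (Ident C G) (HomAdd C (neg (s \<cdot> g)) (s \<cdot> g))"
    by (rule add_assoc[OF ident_closed[OF o(2)] neg_hom[OF sg] sg])
  also have "\<dots> = Ident C G"
    using add_neg(2)[OF sg] add_zero_right[OF ident_closed[OF o(2)]] by simp
  finally have "is_biproduct C P K G s k g r"
    unfolding is_biproduct_def using o oK s g k r gs gk rk rs by blast
  then show thesis using that by blast
qed

section \<open>Retracts, and the breaking up of short exact sequences\<close>

lemma retract_mem:
  assumes R: "additive_subcategory C R" and f: "f \<in> Hom C X Y" and h: "h \<in> Hom C Y X"
    and i: "f \<cdot> h = Ident C Y" and X: "X \<in> R"
  shows "Y \<in> R"
proof -
  obtain K k r where "is_biproduct C Y K X h k f r" using split_epi_biproduct[OF h f i] .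
  then show ?thesis using additive_subcategory_biproduct[OF R] X by blast
qed

lemma middle_mem_of_zero_left:
  assumes R: "additive_subcategory C R" and s: "short_exact C X f E g Y"
    and X: "is_zero_object C X" and Y: "Y \<in> R"
  shows "E \<in> R"
proof -
  note d = short_exactD[OF s]
  have E: "E \<in> Obj C" using Hom_obj[OF d(1)] by blast
  have "Ident C E \<cdot> f = HomZero C X E" using zero_object_hom(2)[OF X d(1)] d(1) by (simp add: Hom_def)
  then obtain u where "u \<in> Hom C Y E" "u \<cdot> g = Ident C E"
    using cokernel_factor[OF short_exact_cokernel[OF s] d(2,1) ident_closed[OF E]] by blast
  then show ?thesis using retract_mem[OF R _ d(2)] Y by blast
qed

text \<open>With \<open>N\<close> zero, the identity of \<open>M\<close> factors through the kernel
  \<open>f\<close>; a mono with a right inverse is invertible, so \<open>K\<close> is a retract of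
  \<open>M\<close>.\<close>

lemma left_mem_of_zero_right:
  assumes R: "additive_subcategory C R" and s: "short_exact C K f M g N"
    and N: "is_zero_object C N" and M: "M \<in> R"
  shows "K \<in> R"
proof -
  note d = short_exactD[OF s]
  have o: "K \<in> Obj C" "M \<in> Obj C" using Hom_obj[OF d(1)] by blast+
  have "g \<cdot> Ident C M = HomZero C M N" using zero_object_hom(1)[OF N d(2)] d(2) by (simp add: Hom_def)
  then obtain u where u: "u \<in> Hom C M K" "f \<cdot> u = Ident C M"
    using kernel_factor[OF d(3,1,2) ident_closed[OF o(2)]] by blast
  have "f \<cdot> (u \<cdot> f) = (f \<cdot> u) \<cdot> f" using comp_assoc[OF d(1) u(1) d(1)] by simp
  also have "\<dots> = f \<cdot> Ident C K" using u d(1) by (simp add: Hom_def)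
  finally have "u \<cdot> f = Ident C K"
    using mono_cancel[OF kernel_mono[OF d(3,1)] d(1) comp_closed[OF d(1) u(1)] ident_closed[OF o(1)]]
    by simp
  then show ?thesis using retract_mem[OF R u(1) d(1)] M by blast
qed

text \<open>\<open>L\<close> is the preimage of \<open>B\<close> in \<open>M\<close>, constructed as
  the kernel of \<open>pA \<cdot> g\<close>, and \<open>q\<close> is the restriction of
  \<open>pB \<cdot> g\<close> to it. An arrow into \<open>L\<close> killed by \<open>q\<close> has
  both components of its image in \<open>N\<close> zero, hence comes from \<open>K\<close>. The
  splitting serves kernels, where \<open>M\<close> is known, and extensions, where \<open>K\<close>
  is known.\<close>

lemma short_exact_split_quotient:
  assumes ep: "enough_projectives C" and s: "short_exact C K k M g N"
    and b: "is_biproduct C A B N iA iB pA pB"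
  obtains L l k' q where "short_exact C L l M (pA \<cdot> g) A" "short_exact C K k' L q B"
proof -
  note d = short_exactD[OF s]
  have b': "iA \<in> Hom C A N" "iB \<in> Hom C B N" "pA \<in> Hom C N A" "pB \<in> Hom C N B"
    "pA \<cdot> iA = Ident C A" "pB \<cdot> iB = Ident C B" "pA \<cdot> iB = HomZero C B A"
    "A \<in> Obj C" "B \<in> Obj C"
    using b by (auto simp: is_biproduct_def)
  have o: "K \<in> Obj C" "M \<in> Obj C" "N \<in> Obj C" using Hom_obj d(1,2) by blast+
  have pg: "pA \<cdot> g \<in> Hom C M A" using comp_closed[OF d(2) b'(3)] .
  have "is_epi C (Ident C A)"
    by (rule is_epiI[OF ident_closed[OF b'(8)]]) (simp add: Hom_def)
  then have "is_epi C pA" using epi_comp_imp_epi[OF _ b'(1,3)] b'(5) by simp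
  then have epi1: "is_epi C (pA \<cdot> g)" by (rule epi_comp[OF d(4) _ d(2) b'(3)])
  obtain L l where l: "l \<in> Hom C L M" "is_kernel C l (pA \<cdot> g)" using kernel_exists[OF pg] .
  have 1: "short_exact C L l M (pA \<cdot> g) A" by (rule short_exactI[OF l(1) pg l(2) epi1])
  have ml: "is_mono C l" using kernel_mono[OF l(2,1)] .
  let ?q = "pB \<cdot> (g \<cdot> l)"
  have gl: "g \<cdot> l \<in> Hom C L N" using comp_closed[OF l(1) d(2)] .
  have q: "?q \<in> Hom C L B" using comp_closed[OF gl b'(4)] .
  have factor_l: "\<exists>u. u \<in> Hom C W L \<and> l \<cdot> u = h"
    if "h \<in> Hom C W M" "pA \<cdot> (g \<cdot> h) = HomZero C W A" for h W
    using kernel_factor[OF l(2,1) pg that(1)] that(2) comp_assoc[OF that(1) d(2) b'(3)] by metis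
  have "is_epi C ?q"
  proof -
    \<comment> \<open>The lift \<open>v\<close> of \<open>iB \<cdot> e\<close> along
      \<open>g\<close> is killed by \<open>pA \<cdot> g\<close> because \<open>pA \<cdot> iB\<close>
      is zero. Hence it lands in \<open>L\<close>, and \<open>q\<close> composed with it is the epi
      \<open>e\<close>.\<close>
    obtain P e where P: "is_projective C P" "e \<in> Hom C P B" "is_epi C e"
      using ep b'(9) unfolding enough_projectives_def by blast
    have ie: "iB \<cdot> e \<in> Hom C P N" using comp_closed[OF P(2) b'(2)] .
    have "\<exists>v \<in> Hom C P (Dom C g). g \<cdot> v = iB \<cdot> e"
      using P(1) d(2,4) ie unfolding is_projective_def Hom_def by auto
    then obtain v where v: "v \<in> Hom C P M" "g \<cdot> v = iB \<cdot> e" using d(2) by (auto simp: Hom_def)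
    have "pA \<cdot> (g \<cdot> v) = HomZero C P A" using comp_comp_zero[OF b'(2,3,7) P(2)] v(2) by simp
    then obtain u where u: "u \<in> Hom C P L" "l \<cdot> u = v" using factor_l[OF v(1)] by blast
    have "?q \<cdot> u = pB \<cdot> (g \<cdot> (l \<cdot> u))" using u b' d l by (simp add: Hom_def)
    also have "\<dots> = pB \<cdot> (iB \<cdot> e)" using u v by simp
    also have "\<dots> = (pB \<cdot> iB) \<cdot> e" by (rule comp_assoc[OF P(2) b'(2,4), symmetric])
    also have "\<dots> = e" using b'(6) P(2) by (simp add: Hom_def)
    finally show ?thesis using epi_comp_imp_epi[OF _ u(1) q] P(3) by simp
  qed
  moreover
  have gk: "g \<cdot> k = HomZero C K N" using kernel_comp[OF d(3,1,2)] .
  then have "pA \<cdot> (g \<cdot> k) = HomZero C K A" using b'(3) o by (simp add: Hom_def)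
  then obtain k' where k': "k' \<in> Hom C K L" "l \<cdot> k' = k" using factor_l[OF d(1)] by blast
  have "is_kernel C k' ?q"
  proof (rule is_kernelI[OF k'(1) q])
    show "is_mono C k'"
    proof (rule is_monoI[OF k'(1)])
      fix W w assume w: "w \<in> Hom C W K" "k' \<cdot> w = HomZero C W L"
      have "k \<cdot> w = l \<cdot> (k' \<cdot> w)" using comp_assoc[OF w(1) k'(1) l(1)] k'(2) by simp
      also have "\<dots> = HomZero C W M" using w l(1) Hom_obj[OF w(1)] by (simp add: Hom_def)
      finally show "w = HomZero C W K" using mono_zero[OF kernel_mono[OF d(3,1)] d(1) w(1)] by simp
    qed
    have "?q \<cdot> k' = pB \<cdot> (g \<cdot> (l \<cdot> k'))" using k'(1) b' d l by (simp add: Hom_def)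
    also have "\<dots> = HomZero C K B" using k'(2) gk b'(4) o by (simp add: Hom_def)
    finally show "?q \<cdot> k' = HomZero C K B" .
    fix W h assume h: "h \<in> Hom C W L" "?q \<cdot> h = HomZero C W B"
    have lh: "l \<cdot> h \<in> Hom C W M" using comp_closed[OF h(1) l(1)] .
    have "pA \<cdot> (g \<cdot> (l \<cdot> h)) = HomZero C W A"
      using comp_comp_zero[OF l(1) pg kernel_comp[OF l(2,1) pg] h(1)] comp_assoc[OF lh d(2) b'(3)]
      by simp
    moreover have "pB \<cdot> (g \<cdot> (l \<cdot> h)) = HomZero C W B" using h b' d l by (simp add: Hom_def)
    ultimately have "g \<cdot> (l \<cdot> h) = HomZero C W N"
      using biproduct_zero_in[OF b comp_closed[OF lh d(2)]] by blast
    then obtain u where u: "u \<in> Hom C W K" "k \<cdot> u = l \<cdot> h"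
      using kernel_factor[OF d(3,1,2) lh] by blast
    have "l \<cdot> (k' \<cdot> u) = l \<cdot> h" using comp_assoc[OF u(1) k'(1) l(1)] k'(2) u(2) by simp
    then have "k' \<cdot> u = h" using mono_cancel[OF ml l(1) comp_closed[OF u(1) k'(1)] h(1)] by simp
    then show "\<exists>u. u \<in> Hom C W K \<and> k' \<cdot> u = h" using u(1) by blast
  qed
  ultimately have "short_exact C K k' L ?q B" using short_exactI[OF k'(1) q] by blast
  with 1 show thesis using that by blast
qed

text \<open>\<open>D\<close> is E/B. As \<open>g\<close> kills the copy of \<open>B\<close>, it
  descends to \<open>h\<close>, whose kernel is the image of \<open>A\<close>.\<close>

lemma short_exact_quotient_summand:
  assumes s: "short_exact C X f E g Y" and b: "is_biproduct C A B X iA iB pA pB"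
  obtains D c h where "c \<in> Hom C E D" "h \<in> Hom C D Y" "h \<cdot> c = g" "short_exact C B (f \<cdot> iB) E c D"
    "short_exact C A (c \<cdot> (f \<cdot> iA)) D h Y"
proof -
  note d = short_exactD[OF s]
  have b': "iA \<in> Hom C A X" "iB \<in> Hom C B X" "pA \<in> Hom C X A" "pB \<in> Hom C X B"
    "pA \<cdot> iA = Ident C A" "pB \<cdot> iB = Ident C B" "pA \<cdot> iB = HomZero C B A"
    "A \<in> Obj C" "B \<in> Obj C"
    using b by (auto simp: is_biproduct_def)
  have mono: "is_mono C f" using kernel_mono[OF d(3,1)] .
  have gf: "g \<cdot> f = HomZero C X Y" using kernel_comp[OF d(3,1,2)] .
  have fA: "f \<cdot> iA \<in> Hom C A E" and fB: "f \<cdot> iB \<in> Hom C B E"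
    using comp_closed[OF _ d(1)] b' by blast+
  obtain D c where c: "c \<in> Hom C E D" "is_cokernel C c (f \<cdot> iB)" using cokernel_exists[OF fB] .
  have cfB: "c \<cdot> (f \<cdot> iB) = HomZero C B D" using cokernel_comp[OF c(2) fB c(1)] .
  obtain h where h: "h \<in> Hom C D Y" "h \<cdot> c = g"
    using cokernel_factor[OF c(2,1) fB d(2) comp_comp_zero[OF d(1,2) gf b'(2)]] .
  have epi_h: "is_epi C h" using epi_comp_imp_epi[OF _ c(1) h(1)] d(4) h(2) by simp
  have epi_c: "is_epi C c" using cokernel_epi[OF c(2,1)] .
  have fB_mono: "is_mono C (f \<cdot> iB)"
  proof (rule is_monoI[OF fB])
    fix W w assume w: "w \<in> Hom C W B" "(f \<cdot> iB) \<cdot> w = HomZero C W E"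
    have iw: "iB \<cdot> w \<in> Hom C W X" using comp_closed[OF w(1) b'(2)] .
    have "iB \<cdot> w = HomZero C W X"
      using mono_zero[OF mono d(1) iw] w comp_assoc[OF w(1) b'(2) d(1)] by simp
    then have "(pB \<cdot> iB) \<cdot> w = HomZero C W B"
      using comp_assoc[OF w(1) b'(2,4)] b'(4) Hom_obj[OF w(1)] by (simp add: Hom_def)
    then show "w = HomZero C W B" using b'(6) w(1) by (simp add: Hom_def)
  qed
  have sB: "short_exact C B (f \<cdot> iB) E c D" by (rule short_exact_of_mono[OF fB c(1) fB_mono c(2)])
  let ?f = "c \<cdot> (f \<cdot> iA)"
  have fh: "?f \<in> Hom C A D" using comp_closed[OF fA c(1)] .
  have f_mono: "is_mono C ?f"
  proof (rule is_monoI[OF fh])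
    fix W w assume w: "w \<in> Hom C W A" "?f \<cdot> w = HomZero C W D"
    have fw: "(f \<cdot> iA) \<cdot> w \<in> Hom C W E" using comp_closed[OF w(1) fA] .
    have iw: "iA \<cdot> w \<in> Hom C W X" using comp_closed[OF w(1) b'(1)] .
    have "c \<cdot> ((f \<cdot> iA) \<cdot> w) = HomZero C W D" using comp_assoc[OF w(1) fA c(1)] w(2) by simp
    \<comment> \<open>An arrow into \<open>A\<close> that dies in E/B comes from \<open>B\<close>
      inside E. As \<open>f\<close> is mono, the two arrows agree already in \<open>X\<close>, and
      projecting to \<open>A\<close> gives zero.\<close>
    then obtain v where v: "v \<in> Hom C W B" "(f \<cdot> iB) \<cdot> v = (f \<cdot> iA) \<cdot> w"
      using kernel_factor[OF short_exactD(3)[OF sB] fB c(1) fw] by blast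
    have "f \<cdot> (iA \<cdot> w) = f \<cdot> (iB \<cdot> v)"
      using comp_assoc[OF v(1) b'(2) d(1)] comp_assoc[OF w(1) b'(1) d(1)] v(2) by simp
    then have e: "iA \<cdot> w = iB \<cdot> v"
      using mono_cancel[OF mono d(1) iw comp_closed[OF v(1) b'(2)]] by simp
    have "w = (pA \<cdot> iA) \<cdot> w" using w(1) b'(5) by (simp add: Hom_def)
    also have "\<dots> = pA \<cdot> (iB \<cdot> v)" using comp_assoc[OF w(1) b'(1,3)] e by simp
    also have "\<dots> = HomZero C W A" by (rule comp_comp_zero[OF b'(2,3,7) v(1)])
    finally show "w = HomZero C W A" .
  qed
  have "is_cokernel C h ?f"
  proof (rule is_cokernelI[OF h(1) fh epi_h])
    have "h \<cdot> ?f = g \<cdot> (f \<cdot> iA)" using comp_assoc[OF fA c(1) h(1)] h(2) by simp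
    then show "h \<cdot> ?f = HomZero C A Y" using comp_comp_zero[OF d(1,2) gf b'(1)] by simp
    fix W t assume t: "t \<in> Hom C D W" "t \<cdot> ?f = HomZero C A W"
    \<comment> \<open>Pulled back to \<open>E\<close>, \<open>t\<close> kills both summands of
      \<open>X\<close>, hence factors through \<open>g\<close>, that is, through
      \<open>h \<cdot> c\<close>; the epi \<open>c\<close> then cancels.\<close>
    have tc: "t \<cdot> c \<in> Hom C E W" using comp_closed[OF c(1) t(1)] .
    have tcf: "(t \<cdot> c) \<cdot> f \<in> Hom C X W" using comp_closed[OF d(1) tc] .
    have "((t \<cdot> c) \<cdot> f) \<cdot> iA = t \<cdot> ?f"
      using comp_assoc[OF b'(1) d(1) tc] comp_assoc[OF fA c(1) t(1)] by simp
    moreover have "((t \<cdot> c) \<cdot> f) \<cdot> iB = t \<cdot> (c \<cdot> (f \<cdot> iB))"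
      using comp_assoc[OF b'(2) d(1) tc] comp_assoc[OF fB c(1) t(1)] by simp
    moreover have "\<dots> = HomZero C B W" using cfB t(1) b'(9) by (simp add: Hom_def)
    ultimately have "(t \<cdot> c) \<cdot> f = HomZero C X W"
      using biproduct_zero_out[OF b tcf] t(2) by simp
    then obtain u where u: "u \<in> Hom C Y W" "u \<cdot> g = t \<cdot> c"
      using cokernel_factor[OF short_exact_cokernel[OF s] d(2,1) tc] by blast
    have "(u \<cdot> h) \<cdot> c = t \<cdot> c" using comp_assoc[OF c(1) h(1) u(1)] h(2) u(2) by simp
    then have "u \<cdot> h = t" using epi_cancel[OF epi_c c(1) comp_closed[OF h(1) u(1)] t(1)] by simp
    then show "\<exists>u. u \<in> Hom C Y W \<and> u \<cdot> h = t" using u(1) by blast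
  qed
  then have "short_exact C A ?f D h Y" by (rule short_exact_of_mono[OF fh h(1) f_mono])
  with c h sB show thesis using that by blast
qed

text \<open>The fibre product is never formed: the arrow \<open>m\<close> with components
  \<open>c1\<close>, \<open>c2\<close> is shown to be mono, and \<open>d\<close> to be its
  cokernel.\<close>

lemma short_exact_left_sum:
  assumes s: "short_exact C X f E g Y" and b: "is_biproduct C A B X iA iB pA pB"
  obtains a1 D1 h1 a2 D2 h2 S j1 j2 q1 q2 m d
  where "short_exact C A a1 D1 h1 Y" "short_exact C B a2 D2 h2 Y"
    "is_biproduct C D1 D2 S j1 j2 q1 q2" "short_exact C E m S d Y"
proof -
  obtain D1 c1 h1 where 1: "c1 \<in> Hom C E D1" "h1 \<in> Hom C D1 Y" "h1 \<cdot> c1 = g"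
      "short_exact C B (f \<cdot> iB) E c1 D1" "short_exact C A (c1 \<cdot> (f \<cdot> iA)) D1 h1 Y"
    using short_exact_quotient_summand[OF s b] by blast
  \<comment> \<open>Swapping the summands makes \<open>c2\<close> the quotient by \<open>A\<close>,
    whereas \<open>c1\<close> is the quotient by \<open>B\<close>.\<close>
  obtain D2 c2 h2 where 2: "c2 \<in> Hom C E D2" "h2 \<in> Hom C D2 Y" "h2 \<cdot> c2 = g"
      "short_exact C A (f \<cdot> iA) E c2 D2" "short_exact C B (c2 \<cdot> (f \<cdot> iB)) D2 h2 Y"
    using short_exact_quotient_summand[OF s biproduct_swap[OF b]] by blast
  note x1 = short_exactD[OF 1(4)] and y1 = short_exactD[OF 1(5)]
  note x2 = short_exactD[OF 2(4)] and y2 = short_exactD[OF 2(5)]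
  have o: "D1 \<in> Obj C" "D2 \<in> Obj C" "E \<in> Obj C" using Hom_obj 1 2 by blast+
  obtain S j1 j2 q1 q2 where bs: "is_biproduct C D1 D2 S j1 j2 q1 q2" using biproducts o by blast
  then have j: "j1 \<in> Hom C D1 S" "j2 \<in> Hom C D2 S" "q1 \<in> Hom C S D1" "q2 \<in> Hom C S D2"
    by (auto simp: is_biproduct_def)
  obtain m where m: "m \<in> Hom C E S" "q1 \<cdot> m = c1" "q2 \<cdot> m = c2"
    using biproduct_pairing[OF bs 1(1) 2(1)] .
  \<comment> \<open>The sign makes the two composites to \<open>Y\<close>, both equal to
    \<open>g\<close>, cancel in \<open>d \<cdot> m\<close>.\<close>
  obtain d where d: "d \<in> Hom C S Y" "d \<cdot> j1 = h1" "d \<cdot> j2 = neg h2"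
    using biproduct_copairing[OF bs 1(2) neg_hom[OF 2(2)]] .
  have mono: "is_mono C m"
  proof (rule is_monoI[OF m(1)])
    fix W w assume w: "w \<in> Hom C W E" "m \<cdot> w = HomZero C W S"
    have oW: "W \<in> Obj C" using Hom_obj[OF w(1)] by blast
    have z: "c1 \<cdot> w = HomZero C W D1" "c2 \<cdot> w = HomZero C W D2"
      using comp_assoc[OF w(1) m(1) j(3)] comp_assoc[OF w(1) m(1) j(4)] m(2,3) w(2) j(3,4) oW
      by (simp_all add: Hom_def)
    \<comment> \<open>Killed by \<open>c1\<close>, the arrow \<open>w\<close> comes from
      \<open>B\<close>; but \<open>B\<close> embeds into \<open>D2\<close>, where \<open>c2\<close>
      sends \<open>w\<close> to zero.\<close>
    obtain v where v: "v \<in> Hom C W B" "(f \<cdot> iB) \<cdot> v = w"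
      using kernel_factor[OF x1(3,1) 1(1) w(1) z(1)] .
    have "(c2 \<cdot> (f \<cdot> iB)) \<cdot> v = HomZero C W D2"
      using comp_assoc[OF v(1) x1(1) 2(1)] v(2) z(2) by simp
    then have "v = HomZero C W B" using mono_zero[OF kernel_mono[OF y2(3,1)] y2(1) v(1)] by simp
    moreover have "(f \<cdot> iB) \<cdot> HomZero C W B = HomZero C W E" using x1(1) oW
      by (metis (mono_tags, lifting) Hom_def comp_zero mem_Collect_eq)
    ultimately show "w = HomZero C W E" using v(2) by simp
  qed
  have "is_epi C d" using epi_comp_imp_epi[OF _ j(1) d(1)] d(2) y1(4) by simp
  then have "is_cokernel C d m"
  proof (rule is_cokernelI[OF d(1) m(1)])
    have "d \<cdot> m = HomAdd C (h1 \<cdot> c1) (neg h2 \<cdot> c2)" using biproduct_comp[OF bs m(1) d(1)] m d by simp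
    also have "\<dots> = HomAdd C g (neg g)" using 1(3) 2 neg_comp[of c2 h2] by (simp add: Hom_def)
    also have "\<dots> = HomZero C E Y" using add_neg(1) short_exactD(2)[OF s] by blast
    finally show "d \<cdot> m = HomZero C E Y" .
    fix W t assume t: "t \<in> Hom C S W" "t \<cdot> m = HomZero C E W"
    define a b where "a = t \<cdot> j1" and "b = t \<cdot> j2"
    have a: "a \<in> Hom C D1 W" and bh: "b \<in> Hom C D2 W"
      unfolding a_def b_def using comp_closed[OF _ t(1)] j by blast+
    have oW: "W \<in> Obj C" using Hom_obj[OF a] by blast
    have ac: "a \<cdot> c1 \<in> Hom C E W" and bc: "b \<cdot> c2 \<in> Hom C E W"
      using comp_closed 1(1) 2(1) a bh by blast+
    have "HomAdd C (a \<cdot> c1) (b \<cdot> c2) = HomZero C E W"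
      using biproduct_comp[OF bs m(1) t(1)] m t(2) by (simp add: a_def b_def)
    then have eq: "a \<cdot> c1 = neg b \<cdot> c2"
      using eq_neg_iff[OF ac bc] neg_comp[of c2 b] 2(1) bh by (simp add: Hom_def)
    \<comment> \<open>Restricting \<open>eq\<close> to \<open>A\<close> removes its right-hand side,
      so \<open>a\<close> vanishes on the kernel of \<open>h1\<close> and descends to
      \<open>Y\<close>.\<close>
    have "c2 \<cdot> (f \<cdot> iA) = HomZero C A D2" using kernel_comp[OF x2(3,1) 2(1)] .
    moreover have "a \<cdot> (c1 \<cdot> (f \<cdot> iA)) = neg b \<cdot> (c2 \<cdot> (f \<cdot> iA))"
      using comp_assoc[OF x2(1) 1(1) a] comp_assoc[OF x2(1) 2(1) neg_hom[OF bh]] eq by simp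
    moreover have "neg b \<cdot> HomZero C A D2 = HomZero C A W"
      using neg_hom[OF bh] Hom_obj[OF x2(1)] by (simp add: Hom_def)
    ultimately have "a \<cdot> (c1 \<cdot> (f \<cdot> iA)) = HomZero C A W" by simp
    then obtain u where u: "u \<in> Hom C Y W" "u \<cdot> h1 = a"
      using cokernel_factor[OF short_exact_cokernel[OF 1(5)] 1(2) y1(1) a] by blast
    \<comment> \<open>The same \<open>u\<close> also gives the second component:
      \<open>u \<cdot> h2\<close> and \<open>neg b\<close> agree after the epi
      \<open>c2\<close>.\<close>
    have "(u \<cdot> h2) \<cdot> c2 = (u \<cdot> h1) \<cdot> c1"
      using comp_assoc[OF 2(1,2) u(1)] comp_assoc[OF 1(1,2) u(1)] 1(3) 2(3) by simp
    then have "u \<cdot> h2 = neg b"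
      using epi_cancel[OF x2(4) 2(1) comp_closed[OF 2(2) u(1)] neg_hom[OF bh]] u(2) eq by simp
    moreover have "u \<cdot> neg h2 = neg (u \<cdot> h2)" using comp_neg[of h2 u] 2(2) u(1) by (simp add: Hom_def)
    ultimately have "u \<cdot> neg h2 = b" using neg_neg[of b] bh by (simp add: Hom_def)
    then have "(u \<cdot> d) \<cdot> j2 = t \<cdot> j2" using comp_assoc[OF j(2) d(1) u(1)] d(3) b_def by simp
    moreover have "(u \<cdot> d) \<cdot> j1 = t \<cdot> j1" using comp_assoc[OF j(1) d(1) u(1)] d(2) u(2) a_def by simp
    ultimately have "u \<cdot> d = t"
      using biproduct_eq_out[OF bs comp_closed[OF d(1) u(1)] t(1)] by blast
    then show "\<exists>u. u \<in> Hom C Y W \<and> u \<cdot> d = t" using u(1) by blast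
  qed
  then have "short_exact C E m S d Y" by (rule short_exact_of_mono[OF m(1) d(1) mono])
  with 1(5) 2(5) bs show thesis using that by blast
qed

section \<open>Induction over decompositions into indecomposables\<close>

text \<open>The premises are those of a direct sum with joint cancellation of the inclusions in
  place of the sum formula. In this form they are inherited by the complement of the last summand.
  The family \<open>A\<close> stays fixed; the object, the inclusions and the projections
  vary.\<close>

lemma decomposition_induct:
  fixes n :: nat
  assumes "N \<in> Obj C"
    and "\<And>k. k < n \<Longrightarrow> i k \<in> Hom C (A k) N \<and> p k \<in> Hom C N (A k)"
    and "\<And>j k. j < n \<Longrightarrow> k < n \<Longrightarrow>
      p j \<cdot> i k = (if j = k then Ident C (A k) else HomZero C (A k) (A j))"
    and "\<And>W h. h \<in> Hom C N W \<Longrightarrow> (\<And>k. k < n \<Longrightarrow> h \<cdot> i k = HomZero C (A k) W) \<Longrightarrow> h = HomZero C N W"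
    and "\<And>k. k < n \<Longrightarrow> indecomposable C (A k)"
    and zero: "\<And>Z. is_zero_object C Z \<Longrightarrow> P Z"
    and sum: "\<And>A B S iA iB pA pB. is_biproduct C A B S iA iB pA pB \<Longrightarrow> indecomposable C A \<Longrightarrow> P B \<Longrightarrow> P S"
  shows "P N"
  using assms(1-5)
proof (induction n arbitrary: N i p)
  case 0
  \<comment> \<open>With no inclusions to test on, the cancellation premise applies to every arrow,
    in particular to the identity.\<close>
  then have "Ident C N = HomZero C N N" using ident_closed by blast
  then show ?case using zero 0 zero_object_iff by blast
next
  case (Suc n)
  have ip: "i k \<in> Hom C (A k) N" "p k \<in> Hom C N (A k)" if "k < Suc n" for k
    using Suc.prems(2)[OF that] by auto
  have "p n \<cdot> i n = Ident C (A n)" using Suc.prems(3)[of n n] by simp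
  then obtain K k r where b: "is_biproduct C (A n) K N (i n) k (p n) r"
    using split_epi_biproduct[OF ip(1)[of n] ip(2)[of n]] by blast
  then have K: "K \<in> Obj C" and k: "k \<in> Hom C K N" and r: "r \<in> Hom C N K"
    and rk: "r \<cdot> k = Ident C K" and ri: "r \<cdot> i n = HomZero C (A n) K"
    by (auto simp: is_biproduct_def)
  have "P K"
  \<comment> \<open>The remaining inclusions are projected to \<open>K\<close> along
    \<open>r\<close>, and the remaining projections are restricted along \<open>k\<close>.\<close>
  proof (rule Suc.IH[of K "\<lambda>j. r \<cdot> i j" "\<lambda>j. p j \<cdot> k"])
    show "K \<in> Obj C" by (rule K)
    show "r \<cdot> i j \<in> Hom C (A j) K \<and> p j \<cdot> k \<in> Hom C K (A j)" if "j < n" for j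
      using comp_closed ip[of j] k r that by (meson less_SucI)
    show "(p j \<cdot> k) \<cdot> (r \<cdot> i l) = (if j = l then Ident C (A l) else HomZero C (A l) (A j))"
      if "j < n" "l < n" for j l
    proof -
      have jl: "j < Suc n" "l < Suc n" using that by auto
      have o: "A l \<in> Obj C" "A j \<in> Obj C" using Hom_obj ip jl by blast+
      have il: "p n \<cdot> i l = HomZero C (A l) (A n)" using Suc.prems(3)[of n l] that by simp
      have pj: "p j \<cdot> i n = HomZero C (A n) (A j)" using Suc.prems(3)[of j n] that by simp
      have w: "(p j \<cdot> k) \<cdot> (r \<cdot> i l) \<in> Hom C (A l) (A j)"
        using comp_closed ip(1)[OF jl(2)] ip(2)[OF jl(1)] k r by meson
      \<comment> \<open>Expanding over \<open>A n\<close> and \<open>K\<close>, the part through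
        \<open>A n\<close> vanishes since neither index is \<open>n\<close>, so orthogonality
        survives on \<open>K\<close>.\<close>
      have "p j \<cdot> i l = HomAdd C ((p j \<cdot> i n) \<cdot> (p n \<cdot> i l)) ((p j \<cdot> k) \<cdot> (r \<cdot> i l))"
        by (rule biproduct_comp[OF b ip(1)[OF jl(2)] ip(2)[OF jl(1)]])
      also have "(p j \<cdot> i n) \<cdot> (p n \<cdot> i l) = HomZero C (A l) (A j)"
        unfolding il pj using o b by (simp add: is_biproduct_def)
      also have "HomAdd C (HomZero C (A l) (A j)) ((p j \<cdot> k) \<cdot> (r \<cdot> i l)) = (p j \<cdot> k) \<cdot> (r \<cdot> i l)"
        by (rule add_zero_left[OF w])
      finally show ?thesis using Suc.prems(3)[OF jl] by simp
    qed
    show "h = HomZero C K W"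
      if h: "h \<in> Hom C K W" and z: "\<And>j. j < n \<Longrightarrow> h \<cdot> (r \<cdot> i j) = HomZero C (A j) W" for W h
    proof -
      have W: "W \<in> Obj C" using Hom_obj[OF h] by blast
      have hr: "h \<cdot> r \<in> Hom C N W" using comp_closed[OF r h] .
      \<comment> \<open>Extended along \<open>r\<close>, \<open>h\<close> vanishes on the removed
        summand as well, because \<open>r \<cdot> i n\<close> is zero; the cancellation premise for
        \<open>N\<close> then applies.\<close>
      have "(h \<cdot> r) \<cdot> i j = HomZero C (A j) W" if "j < Suc n" for j
      proof (cases "j = n")
        case True
        then show ?thesis using comp_assoc[OF ip(1)[OF that] r h] ri h Hom_obj[OF ip(1)[OF that]]
          by (simp add: Hom_def)
      next
        case False
        then show ?thesis using comp_assoc[OF ip(1)[OF that] r h] z[of j] that by simp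
      qed
      then have "h \<cdot> r = HomZero C N W" using Suc.prems(4)[OF hr] by blast
      then have "(h \<cdot> r) \<cdot> k = HomZero C K W" using k W by (simp add: Hom_def)
      then show ?thesis using comp_assoc[OF k r h] rk h by (simp add: Hom_def)
    qed
    show "indecomposable C (A j)" if "j < n" for j using Suc.prems(5)[of j] that by simp
  qed
  then show ?case using sum[OF b] Suc.prems(5)[of n] by blast
qed

text \<open>Local endomorphism rings supply indecomposable summands. In the step, \<open>P\<close>
  is available for the complement \<open>B\<close> only; about \<open>A\<close> nothing beyond
  indecomposability is assumed.\<close>

lemma krull_schmidt_induct:
  assumes ks: "krull_schmidt C" and N: "N \<in> Obj C"
    and zero: "\<And>Z. is_zero_object C Z \<Longrightarrow> P Z"
    and sum: "\<And>A B S iA iB pA pB. is_biproduct C A B S iA iB pA pB \<Longrightarrow> indecomposable C A \<Longrightarrow> P B \<Longrightarrow> P S"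
  shows "P N"
proof -
  obtain n A i p where d: "is_direct_sum C n A N i p" and l: "\<And>k. k < n \<Longrightarrow> local_ring (end_ring C (A k))"
    using ks N unfolding krull_schmidt_def by blast
  have ip: "A k \<in> Obj C" "i k \<in> Hom C (A k) N \<and> p k \<in> Hom C N (A k)" if "k < n" for k
    using d that unfolding is_direct_sum_def by blast+
  have pi: "p j \<cdot> i k = (if j = k then Ident C (A k) else HomZero C (A k) (A j))"
    if "j < n" "k < n" for j k
    using d that unfolding is_direct_sum_def by blast
  show ?thesis
    by (rule decomposition_induct[where P = P, OF N ip(2) pi direct_sum_jointly_epic[OF d]
          local_end_indecomposable[OF ip(1) l] zero sum])
qed

section \<open>Resolving conditions and their indecomposable versions\<close>

lemma projective_mem:
  assumes R: "additive_subcategory C R" and g: "generating C R" and P: "is_projective C P"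
  shows "P \<in> R"
proof -
  have oP: "P \<in> Obj C" using P by (simp add: is_projective_def)
  then obtain G g where G: "G \<in> R" "g \<in> Hom C G P" "is_epi C g"
    using g unfolding generating_def by blast
  \<comment> \<open>Lifting the identity splits the epi from the generator, so \<open>P\<close> is a
    retract of \<open>G\<close>.\<close>
  have "\<exists>u \<in> Hom C P (Dom C g). g \<cdot> u = Ident C P"
    using P G(2,3) ident_closed[OF oP] unfolding is_projective_def Hom_def by auto
  then show ?thesis using retract_mem[OF R G(2) _ _ G(1)] G(2) by (auto simp: Hom_def)
qed

lemma epi_kernels_from_indecomposable:
  assumes ks: "krull_schmidt C" and ep: "enough_projectives C" and R: "additive_subcategory C R"
    and ker: "\<And>K f M g Y. short_exact C K f M g Y \<Longrightarrow> M \<in> R \<Longrightarrow> Y \<in> R \<Longrightarrow> indecomposable C Y \<Longrightarrow> K \<in> R"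
  shows "closed_under_epi_kernels C R"
proof -
  \<comment> \<open>The quantifiers belong to the induction predicate, since the hypothesis for
    \<open>B\<close> is applied with \<open>L\<close> as middle term instead of
    \<open>M\<close>.\<close>
  have "\<forall>K f M g. short_exact C K f M g N \<longrightarrow> M \<in> R \<longrightarrow> N \<in> R \<longrightarrow> K \<in> R" if "N \<in> Obj C" for N
  proof (rule krull_schmidt_induct[OF ks that])
    fix Z assume "is_zero_object C Z"
    then show "\<forall>K f M g. short_exact C K f M g Z \<longrightarrow> M \<in> R \<longrightarrow> Z \<in> R \<longrightarrow> K \<in> R"
      using left_mem_of_zero_right[OF R] by blast
  next
    fix A B S iA iB pA pB
    assume b: "is_biproduct C A B S iA iB pA pB" and A: "indecomposable C A"
      and IH: "\<forall>K f M g. short_exact C K f M g B \<longrightarrow> M \<in> R \<longrightarrow> B \<in> R \<longrightarrow> K \<in> R"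
    show "\<forall>K f M g. short_exact C K f M g S \<longrightarrow> M \<in> R \<longrightarrow> S \<in> R \<longrightarrow> K \<in> R"
    proof (intro allI impI)
      fix K f M g assume s: "short_exact C K f M g S" and M: "M \<in> R" and S: "S \<in> R"
      have AB: "A \<in> R" "B \<in> R" using additive_subcategory_biproduct[OF R b] S by auto
      obtain L l k q where "short_exact C L l M (pA \<cdot> g) A" "short_exact C K k L q B"
        using short_exact_split_quotient[OF ep s b] .
      then show "K \<in> R" using ker M A AB IH by blast
    qed
  qed
  then show ?thesis
    unfolding closed_under_epi_kernels_def using short_exactD(2) Hom_obj by blast
qed

lemma extensions_from_indecomposable:
  assumes ks: "krull_schmidt C" and ep: "enough_projectives C" and R: "additive_subcategory C R"
    and ext: "\<And>X f E g Y. short_exact C X f E g Y \<Longrightarrow>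
      X \<in> R \<Longrightarrow> indecomposable C X \<Longrightarrow> Y \<in> R \<Longrightarrow> indecomposable C Y \<Longrightarrow> E \<in> R"
    and ker: "\<And>K f M g Y. short_exact C K f M g Y \<Longrightarrow> M \<in> R \<Longrightarrow> Y \<in> R \<Longrightarrow> indecomposable C Y \<Longrightarrow> K \<in> R"
  shows "closed_under_extensions C R"
proof -
  \<comment> \<open>Induction on the left end, with the right end indecomposable.\<close>
  have 1: "\<forall>f E g Y. short_exact C X f E g Y \<longrightarrow> X \<in> R \<longrightarrow> Y \<in> R \<longrightarrow> indecomposable C Y \<longrightarrow> E \<in> R"
    if "X \<in> Obj C" for X
  proof (rule krull_schmidt_induct[OF ks that])
    fix Z assume "is_zero_object C Z"
    then show "\<forall>f E g Y. short_exact C Z f E g Y \<longrightarrow> Z \<in> R \<longrightarrow> Y \<in> R \<longrightarrow> indecomposable C Y \<longrightarrow> E \<in> R"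
      using middle_mem_of_zero_left[OF R] by blast
  next
    fix A B S iA iB pA pB
    assume b: "is_biproduct C A B S iA iB pA pB" and A: "indecomposable C A"
      and IH: "\<forall>f E g Y. short_exact C B f E g Y \<longrightarrow> B \<in> R \<longrightarrow> Y \<in> R \<longrightarrow> indecomposable C Y \<longrightarrow> E \<in> R"
    show "\<forall>f E g Y. short_exact C S f E g Y \<longrightarrow> S \<in> R \<longrightarrow> Y \<in> R \<longrightarrow> indecomposable C Y \<longrightarrow> E \<in> R"
    proof (intro allI impI)
      fix f E g Y
      assume s: "short_exact C S f E g Y" and S: "S \<in> R" and Y: "Y \<in> R" "indecomposable C Y"
      have AB: "A \<in> R" "B \<in> R" using additive_subcategory_biproduct[OF R b] S by auto
      obtain a1 D1 h1 a2 D2 h2 T j1 j2 q1 q2 m d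
        where t: "short_exact C A a1 D1 h1 Y" "short_exact C B a2 D2 h2 Y"
          "is_biproduct C D1 D2 T j1 j2 q1 q2" "short_exact C E m T d Y"
        using short_exact_left_sum[OF s b] .
      \<comment> \<open>Both ends of the sequence for \<open>D1\<close> are indecomposable; the one
        for \<open>D2\<close> has left end \<open>B\<close> and is covered by the induction.\<close>
      have "D1 \<in> R" using ext[OF t(1)] A AB Y by blast
      moreover have "D2 \<in> R" using IH t(2) AB Y by blast
      ultimately have "T \<in> R" using additive_subcategory_biproduct[OF R t(3)] by blast
      then show "E \<in> R" using ker[OF t(4)] Y by blast
    qed
  qed
  have "\<forall>X f E g. short_exact C X f E g Y \<longrightarrow> X \<in> R \<longrightarrow> Y \<in> R \<longrightarrow> E \<in> R" if "Y \<in> Obj C" for Y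
  proof (rule krull_schmidt_induct[OF ks that])
    fix Z assume Z: "is_zero_object C Z"
    show "\<forall>X f E g. short_exact C X f E g Z \<longrightarrow> X \<in> R \<longrightarrow> Z \<in> R \<longrightarrow> E \<in> R"
    proof (intro allI impI)
      fix X f E g assume s: "short_exact C X f E g Z" and X: "X \<in> R"
      note d = short_exactD[OF s]
      have E: "E \<in> Obj C" using Hom_obj[OF d(1)] by blast
      have "g \<cdot> Ident C E = HomZero C E Z" using zero_object_hom(1)[OF Z d(2)] d(2) by (simp add: Hom_def)
      then obtain u where "u \<in> Hom C E X" "f \<cdot> u = Ident C E"
        using kernel_factor[OF d(3,1,2) ident_closed[OF E]] by blast
      then show "E \<in> R" using retract_mem[OF R d(1)] X by blast
    qed
  next
    fix A B S iA iB pA pB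
    assume b: "is_biproduct C A B S iA iB pA pB" and A: "indecomposable C A"
      and IH: "\<forall>X f E g. short_exact C X f E g B \<longrightarrow> X \<in> R \<longrightarrow> B \<in> R \<longrightarrow> E \<in> R"
    show "\<forall>X f E g. short_exact C X f E g S \<longrightarrow> X \<in> R \<longrightarrow> S \<in> R \<longrightarrow> E \<in> R"
    proof (intro allI impI)
      fix X f E g assume s: "short_exact C X f E g S" and X: "X \<in> R" and S: "S \<in> R"
      have AB: "A \<in> R" "B \<in> R" using additive_subcategory_biproduct[OF R b] S by auto
      obtain L l k q where t: "short_exact C L l E (pA \<cdot> g) A" "short_exact C X k L q B"
        using short_exact_split_quotient[OF ep s b] .
      \<comment> \<open>\<open>L\<close> is an extension of \<open>B\<close> by \<open>X\<close>,
        and \<open>E\<close> one of the indecomposable \<open>A\<close> by \<open>L\<close>. As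
        \<open>L\<close> may decompose, the second needs fact \<open>1\<close> for arbitrary left
        ends.\<close>
      have "L \<in> R" using IH t(2) X AB by blast
      moreover have "L \<in> Obj C" using Hom_obj[OF short_exactD(1)[OF t(1)]] by blast
      ultimately show "E \<in> R" using 1 t(1) A AB by blast
    qed
  qed
  then show ?thesis
    unfolding closed_under_extensions_def using short_exactD(2) Hom_obj by blast
qed

end

theorem theorem2p11:
  fixes C :: "('o, 'm) preadditive" and R :: "'o set"
  assumes "abelian_category C"
    and "krull_schmidt C"
    and "enough_projectives C"
    and "additive_subcategory C R"
  shows "resolving C R \<longleftrightarrow>
    (\<forall>P. is_projective C P \<longrightarrow> P \<in> R) \<and>
    (\<forall>X f E g Y. short_exact C X f E g Y \<longrightarrow>
        X \<in> R \<longrightarrow> indecomposable C X \<longrightarrow> Y \<in> R \<longrightarrow> indecomposable C Y \<longrightarrow> E \<in> R) \<and>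
    (\<forall>K f M g Y. short_exact C K f M g Y \<longrightarrow>
        M \<in> R \<longrightarrow> Y \<in> R \<longrightarrow> indecomposable C Y \<longrightarrow> K \<in> R)"
    (is "_ \<longleftrightarrow> ?proj \<and> ?ext \<and> ?ker")
proof
  interpret abelian_category C by (rule assms(1))
  assume "resolving C R"
  then have r: "generating C R" "closed_under_extensions C R" "closed_under_epi_kernels C R"
    by (auto simp: resolving_def)
  have ?proj using projective_mem[OF assms(4) r(1)] by blast
  moreover have ?ext using r(2) unfolding closed_under_extensions_def by blast
  moreover have ?ker using r(3) unfolding closed_under_epi_kernels_def by blast
  ultimately show "?proj \<and> ?ext \<and> ?ker" by blast
next
  interpret abelian_category C by (rule assms(1))
  assume h: "?proj \<and> ?ext \<and> ?ker"
  \<comment> \<open>The projective covering a given object is itself the required generator by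
    \<open>?proj\<close>.\<close>
  have "generating C R"
    using h assms(3) unfolding generating_def enough_projectives_def by meson
  moreover have "closed_under_extensions C R"
    using extensions_from_indecomposable[OF assms(2-4)] h by blast
  moreover have "closed_under_epi_kernels C R"
    using epi_kernels_from_indecomposable[OF assms(2-4)] h by blast
  ultimately show "resolving C R" using assms(4) by (simp add: resolving_def)
qed

end
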